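(* Let $n\ge 2$ be an integer. The automorphism group of $\mathrm{Aut}(B_n(\mathbf{R}))$ equals $\mathrm{Aut}(B_n(\mathbf{R}))$; that is, the canonical homomorphism $\mathrm{Aut}(B_n(\mathbf{R}))\to\mathrm{Aut}(\mathrm{Aut}(B_n(\mathbf{R})))$ sending each element to the inner automorphism it induces is an isomorphism (so $\mathrm{Aut}(B_n(\mathbf{R}))$ is a complete group: it has trivial center and trivial outer automorphism group).
   Context: Functions are written to the right of their arguments and composed from left to right. For an integer $n\ge 2$: $\mathbf{Z}[\frac1n]=\{an^b : a,b\in\mathbf{Z}\}$ and $\langle n\rangle=\{n^k : k\in\mathbf{Z}\}$. A break of a piecewise linear (PL) function is a point where its derivative is discontinuous. $A_n(\mathbf{R})$ is the group of all homeomorphisms $h:\mathbf{R}\to\mathbf{R}$ such that (1) $h$ preserves orientation, (2) $h$ is PL, (3) all slopes of $h$ are in $\langle n\rangle$, (4) the breaks of $h$ lie in a discrete subset of $\mathbf{Z}[\frac1n]$, (5) $(\mathbf{Z}[\frac1n])h=\mathbf{Z}[\frac1n]$. Let $\phi_n:\mathbf{Z}[\frac1n]\to\mathbf{Z}_{n-1}=\mathbf{Z}/(n-1)\mathbf{Z}$ be the well-defined surjective ring homomorphism $(an^b)\phi_n=a\pmod{n-1}$. There is a well-defined homomorphism $\rho_n:A_n(\mathbf{R})\to\mathbf{Z}_{n-1}$, $f\rho_n=(xf)\phi_n-x\phi_n$ for any $x\in\mathbf{Z}[\frac1n]$, and $B_n(\mathbf{R})=\ker\rho_n$. *)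

theory Defs
  imports "HOL-Analysis.Analysis" "HOL-Algebra.Bij" "HOL-Algebra.Elementary_Groups"
begin

definition Z_inv :: "nat \<Rightarrow> real set" where
  "Z_inv n = {of_int a * real n powi b |a b. True}"

definition n_powers :: "nat \<Rightarrow> real set" where
  "n_powers n = {real n powi k |k. True}"

text \<open>
  The set \<open>S\<close> below has no limit point in the real line, so every bounded interval meets only
  finitely many pieces. Affinity is required on the closed intervals, which includes continuity.
\<close>
definition piecewise_linear :: "(real \<Rightarrow> real) \<Rightarrow> bool" where
  "piecewise_linear h \<longleftrightarrow>
     (\<exists>S. closed S \<and> discrete S \<and>
       (\<forall>p q. p < q \<and> {p<..<q} \<inter> S = {} \<longrightarrow> (\<exists>m c. \<forall>x\<in>{p..q}. h x = m * x + c)))"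

definition slopes :: "(real \<Rightarrow> real) \<Rightarrow> real set" where
  "slopes h = {deriv h x |x. h differentiable (at x)}"

text \<open>The derivative is discontinuous at a point also when it fails to be defined there.\<close>
definition breaks :: "(real \<Rightarrow> real) \<Rightarrow> real set" where
  "breaks h = {x. \<not> ((\<forall>\<^sub>F y in nhds x. h differentiable (at y)) \<and> isCont (deriv h) x)}"

text \<open>A homeomorphism of the real line preserves orientation iff it is increasing.\<close>
definition A_set :: "nat \<Rightarrow> (real \<Rightarrow> real) set" where
  "A_set n = {h. (\<exists>g. homeomorphism UNIV UNIV h g)
               \<and> strict_mono h
               \<and> piecewise_linear h
               \<and> slopes h \<subseteq> n_powers n
               \<and> (\<exists>D \<subseteq> Z_inv n. discrete D \<and> breaks h \<subseteq> D)
               \<and> h ` Z_inv n = Z_inv n}"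

text \<open>Maps act on the right: the product \<open>f \<otimes> g\<close> is first \<open>f\<close>, then \<open>g\<close>.\<close>
definition A_group :: "nat \<Rightarrow> (real \<Rightarrow> real) monoid" where
  "A_group n = \<lparr>carrier = A_set n, monoid.mult = (\<lambda>f g. g \<circ> f), one = id\<rparr>"

text \<open>
  Residue classes modulo \<open>n - 1\<close> are represented by their least non-negative elements, the
  carrier of \<^term>\<open>integer_mod_group (n - 1)\<close>; for \<open>n = 2\<close> the only class is \<open>0\<close>.
\<close>
definition phi :: "nat \<Rightarrow> real \<Rightarrow> int" where
  "phi n x = (THE r. \<exists>a b. x = of_int a * real n powi b \<and> r = a mod (int n - 1))"

definition rho :: "nat \<Rightarrow> (real \<Rightarrow> real) \<Rightarrow> int" where
  "rho n f = (THE r. \<forall>x\<in>Z_inv n. r = (phi n (f x) - phi n x) mod (int n - 1))"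

definition B_group :: "nat \<Rightarrow> (real \<Rightarrow> real) monoid" where
  "B_group n = A_group n \<lparr>carrier := kernel (A_group n) (integer_mod_group (n - 1)) (rho n)\<rparr>"

lemma phi_eq:
  assumes "n \<ge> 2"
  shows "phi n (of_int a * real n powi b) = a mod (int n - 1)"
proof -
  have *: "c mod (int n - 1) = a mod (int n - 1)"
    if eq: "of_int c * real n powi d = of_int a * real n powi b" and le: "b \<le> d"
    for a c b d :: int
  proof -
    define k where "k = nat (d - b)"
    have n0: "real n \<noteq> 0" using assms by simp
    have "real n powi d = real n powi b * real n ^ k"
      using le n0 by (simp add: k_def power_int_add [symmetric] power_int_of_nat [symmetric]
                           del: power_int_of_nat)
    with eq n0 have "of_int c * real n ^ k = of_int a" by simp
    hence "real_of_int (c * int n ^ k) = real_of_int a" by simp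
    hence a: "a = c * int n ^ k" by linarith
    have "int n ^ k mod (int n - 1) = 1 mod (int n - 1)"
      by (metis power_mod power_one diff_add_cancel mod_add_self1)
    thus ?thesis unfolding a by (metis mod_mult_right_eq mult.right_neutral)
  qed
  show ?thesis unfolding phi_def
  proof (rule the_equality)
    fix r assume "\<exists>c d. of_int a * real n powi b = of_int c * real n powi d \<and> r = c mod (int n - 1)"
    then obtain c d where "of_int a * real n powi b = of_int c * real n powi d"
      and "r = c mod (int n - 1)" by blast
    thus "r = a mod (int n - 1)" using *[of c d a b] *[of a b c d] linear[of b d] by metis
  qed blast
qed

text \<open>
  \<^const>\<open>AutoGroup\<close> composes automorphisms from right to left, so the canonical homomorphism sends
  \<open>a\<close> to \<open>g \<mapsto> a \<otimes> g \<otimes> inv a\<close>. Composing from left to right instead, it sends \<open>a\<close> to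
  \<open>g \<mapsto> inv a \<otimes> g \<otimes> a\<close> for the opposite product, which is the same map. The restriction is needed
  because the elements of \<^const>\<open>AutoGroup\<close> are extensional functions.
\<close>
definition inner_map :: "('a, 'b) monoid_scheme \<Rightarrow> 'a \<Rightarrow> 'a \<Rightarrow> 'a" where
  "inner_map G a = (\<lambda>g \<in> carrier G. a \<otimes>\<^bsub>G\<^esub> g \<otimes>\<^bsub>G\<^esub> inv\<^bsub>G\<^esub> a)"

definition group_center :: "('a, 'b) monoid_scheme \<Rightarrow> 'a set" where
  "group_center G = {z \<in> carrier G. \<forall>g\<in>carrier G. z \<otimes>\<^bsub>G\<^esub> g = g \<otimes>\<^bsub>G\<^esub> z}"

definition Out :: "('a, 'b) monoid_scheme \<Rightarrow> ('a \<Rightarrow> 'a) set monoid" where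
  "Out G = AutoGroup G Mod (inner_map G ` carrier G)"

end

theory Submission
  imports Defs
begin

text \<open>
  Write \<open>B\<close> for \<open>B\<^sub>n(R)\<close> and \<open>A\<close> for \<open>Aut(B)\<close>. The centre of \<open>B\<close> is trivial, so \<open>B\<close> is a copy of
  the normal subgroup \<open>Inn(B)\<close> of \<open>A\<close>. By an argument going back to Burnside, \<open>A\<close> is complete as
  soon as every automorphism \<open>t\<close> of \<open>A\<close> maps \<open>Inn(B)\<close> onto itself: the restriction of \<open>t\<close> to
  \<open>Inn(B)\<close> is then an automorphism \<open>f\<close> of \<open>B\<close>, and \<open>t\<close> must be conjugation by \<open>f\<close>. So \<open>Inn(B)\<close> has to
  be recognised inside \<open>A\<close> by a property that refers to the group structure of \<open>A\<close> only.

  The property is this. Call the intersection of all nontrivial normal subgroups of a group its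
  monolith, and call an element locally inner if on every finite subset of the monolith it acts by
  conjugation in the same way as some element of the monolith. Automorphisms preserve both notions.
  The claim is that \<open>Inn(B)\<close> is the set of locally inner elements of \<open>A\<close>
  (\<open>locally_inner_AutoGroup\<close>).

  The monolith \<open>M\<close> of \<open>B\<close> consists of maps with bounded support and, by a commutator argument due to
  Higman, contains every commutator of two elements of \<open>B\<close> with bounded support
  (\<open>commutator_in_M\<close>). Hence on a bounded interval every element of \<open>B\<close> coincides with an element of
  \<open>M\<close> (\<open>M_local\<close>), which makes all of \<open>B\<close> locally inner. The monolith of \<open>A\<close> is the copy of \<open>M\<close> in
  \<open>Inn(B)\<close>, because no nontrivial automorphism of \<open>B\<close> fixes \<open>M\<close> pointwise.

  Conversely, let an automorphism of \<open>B\<close> agree on each finite subset of \<open>M\<close> with conjugation by an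
  element of \<open>M\<close>. For each \<open>N\<close> there are two elements of \<open>M\<close> such that the way in which a map
  conjugates these two determines the map on \<open>[-N, N]\<close> (\<open>determining_pair\<close>). So the conjugating
  elements found for different finite sets are compatible on larger and larger intervals, and they
  fit together to a single homeomorphism (\<open>locally_conj_imp_conj\<close>). It belongs to \<open>B\<close> because
  membership in \<open>B\<close> is a local condition: it is one on germs and on the displacements \<open>xh - x\<close> of the
  points \<open>x\<close> of \<open>Z[1/n]\<close> (\<open>carrier_B_group\<close>).
\<close>

section \<open>Monoliths and locally inner elements\<close>

text \<open>
  The intersection with the carrier only matters for the trivial group, where the family is empty.
\<close>
definition monolith :: "('a, 'b) monoid_scheme \<Rightarrow> 'a set" where
  "monolith G = carrier G \<inter> \<Inter>{K. K \<lhd> G \<and> K \<noteq> {\<one>\<^bsub>G\<^esub>}}"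

definition locally_inner :: "('a, 'b) monoid_scheme \<Rightarrow> 'a set" where
  "locally_inner G = {x \<in> carrier G. \<forall>U. finite U \<and> U \<subseteq> monolith G \<longrightarrow>
     (\<exists>s \<in> monolith G. \<forall>u \<in> U. x \<otimes>\<^bsub>G\<^esub> u \<otimes>\<^bsub>G\<^esub> inv\<^bsub>G\<^esub> x = s \<otimes>\<^bsub>G\<^esub> u \<otimes>\<^bsub>G\<^esub> inv\<^bsub>G\<^esub> s)}"

lemma monolith_carrier: "monolith G \<subseteq> carrier G"
  by (auto simp: monolith_def)

context group
begin

lemma auto_imp_iso: "f \<in> auto G \<Longrightarrow> f \<in> iso G G"
  by (auto simp: auto_def iso_def Bij_def)

text \<open>
  Isomorphisms permute the nontrivial normal subgroups.
\<close>
lemma iso_image_monolith_subset: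
  assumes h: "h \<in> iso G G" shows "h ` monolith G \<subseteq> monolith G"
proof -
  let ?k = "inv_into (carrier G) h"
  have k: "?k \<in> iso G G" using iso_set_sym[OF h] .
  have bij: "bij_betw h (carrier G) (carrier G)" using h by (simp add: iso_def)
  have "h x \<in> K" if x: "x \<in> monolith G" and K: "K \<lhd> G" "K \<noteq> {\<one>}" for x K
  proof -
    have Kc: "K \<subseteq> carrier G" using K(1) normal_imp_subgroup subgroup.subset by blast
    have hK: "h ` ?k ` K = K" using Kc bij by (force simp: image_image bij_betw_def f_inv_into_f)
    have "?k ` K \<noteq> {\<one>}"
    proof
      assume "?k ` K = {\<one>}"
      hence "K = {h \<one>}" using hK by auto
      thus False using K(2) h by (simp add: iso_def hom_one is_group)
    qed
    moreover have "?k ` K \<lhd> G" using iso_normal_subgroup[OF k is_group is_group K(1)] .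
    ultimately have "x \<in> ?k ` K" using x by (auto simp: monolith_def)
    thus ?thesis using hK by blast
  qed
  moreover have "h x \<in> carrier G" if "x \<in> carrier G" for x using bij that by (auto simp: bij_betw_def)
  ultimately show ?thesis by (auto simp: monolith_def)
qed

lemma iso_image_monolith:
  assumes h: "h \<in> iso G G" shows "h ` monolith G = monolith G"
proof -
  let ?k = "inv_into (carrier G) h"
  have "bij_betw h (carrier G) (carrier G)" using h by (simp add: iso_def)
  hence "h ` ?k ` monolith G = monolith G"
    using monolith_carrier[of G] by (force simp: image_image bij_betw_def f_inv_into_f)
  thus ?thesis
    using iso_image_monolith_subset[OF h] iso_image_monolith_subset[OF iso_set_sym[OF h]] by blast
qed

lemma iso_conj:
  assumes "h \<in> iso G G" "x \<in> carrier G" "y \<in> carrier G"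
  shows "h (x \<otimes> y \<otimes> inv x) = h x \<otimes> h y \<otimes> inv (h x)"
proof -
  interpret group_hom G G h using assms(1) by unfold_locales (simp add: iso_def)
  show ?thesis using assms by simp
qed

lemma iso_image_locally_inner_subset:
  assumes h: "h \<in> iso G G" shows "h ` locally_inner G \<subseteq> locally_inner G"
proof -
  have hc: "h x \<in> carrier G" if "x \<in> carrier G" for x
    using h that by (auto simp: iso_def hom_def)
  have "\<exists>s \<in> monolith G. \<forall>u \<in> U. h x \<otimes> u \<otimes> inv (h x) = s \<otimes> u \<otimes> inv s"
    if x: "x \<in> locally_inner G" and U: "finite U" "U \<subseteq> monolith G" for x U
  proof -
    obtain V where V: "V \<subseteq> monolith G" "finite V" "U = h ` V"
      using U iso_image_monolith[OF h] finite_subset_image by metis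
    then obtain s where s: "s \<in> monolith G" "\<forall>v\<in>V. x \<otimes> v \<otimes> inv x = s \<otimes> v \<otimes> inv s"
      using x unfolding locally_inner_def by blast
    have "h x \<otimes> h v \<otimes> inv (h x) = h s \<otimes> h v \<otimes> inv (h s)" if "v \<in> V" for v
    proof -
      have "v \<in> carrier G" "s \<in> carrier G" "x \<in> carrier G"
        using that V s x monolith_carrier[of G] by (auto simp: locally_inner_def)
      thus ?thesis using iso_conj[OF h] s(2) that by metis
    qed
    moreover have "h s \<in> monolith G" using iso_image_monolith_subset[OF h] s(1) by blast
    ultimately show ?thesis using V(3) by blast
  qed
  thus ?thesis using hc by (auto simp: locally_inner_def)
qed

lemma iso_image_locally_inner:
  assumes h: "h \<in> iso G G" shows "h ` locally_inner G = locally_inner G"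
proof -
  let ?k = "inv_into (carrier G) h"
  have "bij_betw h (carrier G) (carrier G)" using h by (simp add: iso_def)
  hence "h ` ?k ` locally_inner G = locally_inner G"
    by (force simp: image_image bij_betw_def f_inv_into_f locally_inner_def)
  thus ?thesis
    using iso_image_locally_inner_subset[OF h] iso_image_locally_inner_subset[OF iso_set_sym[OF h]]
    by blast
qed

lemma conj_mem_monolith:
  assumes g: "g \<in> carrier G" and m: "m \<in> monolith G"
  shows "g \<otimes> m \<otimes> inv g \<in> monolith G"
  using assms by (auto simp: monolith_def normal_inv_iff)

lemma subgroup_monolith: "subgroup (monolith G) G"
proof -
  have "monolith G = \<Inter>(insert (carrier G) {K. K \<lhd> G \<and> K \<noteq> {\<one>}})"
    by (simp add: monolith_def)
  also have "subgroup \<dots> G"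
    by (rule subgroups_Inter) (auto simp: normal_imp_subgroup subgroup_self)
  finally show ?thesis .
qed

lemma auto_closed: "f \<in> auto G \<Longrightarrow> x \<in> carrier G \<Longrightarrow> f x \<in> carrier G"
  by (auto simp: auto_def hom_def)

lemma auto_mult: "f \<in> auto G \<Longrightarrow> x \<in> carrier G \<Longrightarrow> y \<in> carrier G \<Longrightarrow> f (x \<otimes> y) = f x \<otimes> f y"
  by (auto simp: auto_def hom_def)

lemma auto_eqI: "f \<in> auto G \<Longrightarrow> g \<in> auto G \<Longrightarrow> (\<And>x. x \<in> carrier G \<Longrightarrow> f x = g x) \<Longrightarrow> f = g"
  by (auto simp: auto_def Bij_def intro: extensionalityI)

lemma AutoGroup_carrier: "carrier (AutoGroup G) = auto G"
  by (simp add: AutoGroup_def)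

lemma AutoGroup_mult_apply:
  "f \<in> auto G \<Longrightarrow> g \<in> auto G \<Longrightarrow> x \<in> carrier G \<Longrightarrow> (f \<otimes>\<^bsub>AutoGroup G\<^esub> g) x = f (g x)"
  by (auto simp: AutoGroup_def BijGroup_def auto_def compose_def)

lemma AutoGroup_one_apply: "x \<in> carrier G \<Longrightarrow> \<one>\<^bsub>AutoGroup G\<^esub> x = x"
  by (simp add: AutoGroup_def BijGroup_def)

lemma inner_map_apply: "x \<in> carrier G \<Longrightarrow> inner_map G g x = g \<otimes> x \<otimes> inv g"
  by (simp add: inner_map_def)

lemma conj_mult:
  assumes "g \<in> carrier G" "h \<in> carrier G" "x \<in> carrier G"
  shows "(g \<otimes> h) \<otimes> x \<otimes> inv (g \<otimes> h) = g \<otimes> (h \<otimes> x \<otimes> inv h) \<otimes> inv g"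
  using assms by (simp add: inv_mult_group m_assoc)

lemma inner_map_auto:
  assumes g: "g \<in> carrier G" shows "inner_map G g \<in> auto G"
proof -
  have "inner_map G g \<in> hom G G"
    by (rule homI) (use g in \<open>auto simp: inner_map_apply m_assoc inv_solve_left\<close>)
  moreover have "bij_betw (inner_map G g) (carrier G) (carrier G)"
  proof (rule bij_betw_byWitness[where f' = "inner_map G (inv g)"])
    show "\<forall>a\<in>carrier G. inner_map G (inv g) (inner_map G g a) = a"
      using g conj_mult[of "inv g" g] by (simp add: inner_map_apply)
    show "\<forall>a\<in>carrier G. inner_map G g (inner_map G (inv g) a) = a"
      using g conj_mult[of g "inv g"] by (simp add: inner_map_apply)
  qed (use g in \<open>auto simp: inner_map_apply\<close>)
  ultimately show ?thesis by (auto simp: auto_def Bij_def inner_map_def)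
qed

lemma inner_map_hom: "inner_map G \<in> hom G (AutoGroup G)"
proof (rule homI)
  fix x y assume xy: "x \<in> carrier G" "y \<in> carrier G"
  interpret A: group "AutoGroup G" by (rule AutoGroup)
  show "inner_map G (x \<otimes> y) = inner_map G x \<otimes>\<^bsub>AutoGroup G\<^esub> inner_map G y"
    by (rule auto_eqI)
      (use xy A.m_closed[of "inner_map G x" "inner_map G y"] in
        \<open>auto simp: AutoGroup_mult_apply inner_map_auto inner_map_apply conj_mult AutoGroup_carrier\<close>)
qed (simp add: inner_map_auto AutoGroup_carrier)

text \<open>
  Conjugation by \<open>f\<close> acts on the inner automorphisms as \<open>f\<close> itself acts on the group. This formula
  turns statements about \<open>f\<close> into statements about conjugation inside the automorphism group.
\<close>
lemma AutoGroup_conj_inner_map: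
  assumes f: "f \<in> auto G" and g: "g \<in> carrier G"
  shows "f \<otimes>\<^bsub>AutoGroup G\<^esub> inner_map G g \<otimes>\<^bsub>AutoGroup G\<^esub> inv\<^bsub>AutoGroup G\<^esub> f = inner_map G (f g)"
proof -
  interpret A: group "AutoGroup G" by (rule AutoGroup)
  have ac: "f \<in> carrier (AutoGroup G)" "inner_map G g \<in> carrier (AutoGroup G)"
      "inner_map G (f g) \<in> carrier (AutoGroup G)"
    using f g by (auto simp: AutoGroup_carrier inner_map_auto auto_closed)
  have "f \<otimes>\<^bsub>AutoGroup G\<^esub> inner_map G g = inner_map G (f g) \<otimes>\<^bsub>AutoGroup G\<^esub> f"
  proof (rule auto_eqI)
    show "f \<otimes>\<^bsub>AutoGroup G\<^esub> inner_map G g \<in> auto G" "inner_map G (f g) \<otimes>\<^bsub>AutoGroup G\<^esub> f \<in> auto G"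
      using ac A.m_closed by (auto simp: AutoGroup_carrier[symmetric])
    fix x assume "x \<in> carrier G"
    thus "(f \<otimes>\<^bsub>AutoGroup G\<^esub> inner_map G g) x = (inner_map G (f g) \<otimes>\<^bsub>AutoGroup G\<^esub> f) x"
      using f g iso_conj[OF auto_imp_iso[OF f]]
      by (simp add: AutoGroup_mult_apply inner_map_auto auto_closed inner_map_apply)
  qed
  thus ?thesis using ac by (simp add: A.inv_solve_right' A.m_assoc)
qed

end

text \<open>
  Since \<open>e = z \<otimes> f \<otimes> inv z\<close> commutes with \<open>g\<close>, the commutator of \<open>f\<close> and \<open>g\<close> does not change when \<open>f\<close>
  is replaced by \<open>f \<otimes> inv e\<close>, which is a commutator of \<open>f\<close> and \<open>z\<close> and therefore lies in the normal
  subgroup together with \<open>z\<close>.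
\<close>
lemma (in normal) commutator_mem:
  assumes z: "z \<in> H" and f: "f \<in> carrier G" and g: "g \<in> carrier G"
    and c: "(z \<otimes> f \<otimes> inv z) \<otimes> g = g \<otimes> (z \<otimes> f \<otimes> inv z)"
  shows "f \<otimes> g \<otimes> inv f \<otimes> inv g \<in> H"
proof -
  define e where "e = z \<otimes> f \<otimes> inv z"
  have zc: "z \<in> carrier G" using z by simp
  have ec: "e \<in> carrier G" using zc f by (simp add: e_def)
  have eg: "inv e \<otimes> g \<otimes> e = g"
  proof -
    have "inv e \<otimes> g \<otimes> e = inv e \<otimes> (e \<otimes> g)" using c ec g by (simp add: e_def m_assoc)
    thus ?thesis using ec g by (simp add: m_assoc[symmetric])
  qed
  define w where "w = f \<otimes> inv e"
  have wH: "w \<in> H"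
  proof -
    have "inv e = z \<otimes> inv f \<otimes> inv z" using zc f by (simp add: e_def inv_mult_group m_assoc)
    hence "w = (f \<otimes> z \<otimes> inv f) \<otimes> inv z" using zc f by (simp add: w_def m_assoc)
    thus ?thesis using inv_op_closed2[OF f z] z by simp
  qed
  have wc: "w \<in> carrier G" using f ec by (simp add: w_def)
  have "w \<otimes> (g \<otimes> inv w \<otimes> inv g) \<in> H" using wH inv_op_closed2[OF g, of "inv w"] by simp
  also have "w \<otimes> (g \<otimes> inv w \<otimes> inv g) = f \<otimes> (inv e \<otimes> g \<otimes> e) \<otimes> inv f \<otimes> inv g"
    using f g ec by (simp add: w_def inv_mult_group m_assoc)
  finally show ?thesis using eg by simp
qed

section \<open>Completeness of the automorphism group\<close>

text \<open>
  The last two assumptions say that conjugations by elements of the group are exactly those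
  automorphisms that look on every finite part of the monolith like conjugation by an element of the
  monolith. The monolith has to be large enough for its centralizer to be trivial.
\<close>
locale locally_conjugating_group = group +
  assumes monolith_nontrivial: "monolith G \<noteq> {\<one>}"
    and monolith_centralizer: "\<lbrakk>z \<in> carrier G; \<And>m. m \<in> monolith G \<Longrightarrow> z \<otimes> m = m \<otimes> z\<rbrakk> \<Longrightarrow> z = \<one>"
    and carrier_locally_inner: "carrier G \<subseteq> locally_inner G"
    and locally_inner_auto_imp_conj: "\<lbrakk>f \<in> auto G; \<And>U. finite U \<Longrightarrow> U \<subseteq> monolith G \<Longrightarrow>
           \<exists>s\<in>monolith G. \<forall>u\<in>U. f u = s \<otimes> u \<otimes> inv s\<rbrakk> \<Longrightarrow>
         \<exists>g\<in>carrier G. \<forall>u\<in>monolith G. f u = g \<otimes> u \<otimes> inv g"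
begin

abbreviation A where "A \<equiv> AutoGroup G"

sublocale A: group A by (rule AutoGroup)

abbreviation \<iota> where "\<iota> \<equiv> inner_map G"

sublocale \<iota>: group_hom G A \<iota>
  by unfold_locales (rule inner_map_hom)

lemma inner_inj: "inj_on \<iota> (carrier G)"
proof (rule \<iota>.inj_on_one_iff[THEN iffD2], intro allI impI)
  fix x assume x: "x \<in> carrier G" and "\<iota> x = \<one>\<^bsub>A\<^esub>"
  hence e: "x \<otimes> g \<otimes> inv x = g" if "g \<in> carrier G" for g
    using that AutoGroup_one_apply inner_map_apply by metis
  show "x = \<one>"
  proof (rule monolith_centralizer[OF x])
    fix m assume "m \<in> monolith G"
    thus "x \<otimes> m = m \<otimes> x" using e[of m] x subsetD[OF monolith_carrier]
      by (metis inv_solve_right m_closed)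
  qed
qed

lemma inner_eqD: "\<iota> x = \<iota> y \<Longrightarrow> x \<in> carrier G \<Longrightarrow> y \<in> carrier G \<Longrightarrow> x = y"
  by (rule inj_onD[OF inner_inj])

text \<open>
  The element \<open>g\<close> and its image \<open>f g\<close> induce the same conjugation on the monolith, so
  \<open>inv g \<otimes> f g\<close> centralizes it.
\<close>
lemma fixes_monolith_imp_one:
  assumes f: "f \<in> auto G" and fix_m: "\<And>m. m \<in> monolith G \<Longrightarrow> f m = m"
  shows "f = \<one>\<^bsub>A\<^esub>"
proof (rule auto_eqI[OF f])
  show "\<one>\<^bsub>A\<^esub> \<in> auto G" using A.one_closed by (simp add: AutoGroup_carrier)
  fix g assume g: "g \<in> carrier G"
  have fg: "f g \<in> carrier G" using f g by (rule auto_closed)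
  have "inv g \<otimes> f g = \<one>"
  proof (rule monolith_centralizer)
    show "inv g \<otimes> f g \<in> carrier G" using g fg by simp
    fix m assume m: "m \<in> monolith G"
    hence mc: "m \<in> carrier G" using monolith_carrier[of G] by blast
    have "g \<otimes> m \<otimes> inv g = f (g \<otimes> m \<otimes> inv g)"
      using fix_m[OF conj_mem_monolith[OF g m]] by simp
    also have "\<dots> = f g \<otimes> m \<otimes> inv (f g)"
      using iso_conj[OF auto_imp_iso[OF f] g mc] fix_m[OF m] by simp
    finally have "g \<otimes> m \<otimes> inv g \<otimes> f g = f g \<otimes> m"
      using g fg mc by (simp add: m_assoc)
    hence "inv g \<otimes> (g \<otimes> m \<otimes> inv g \<otimes> f g) = inv g \<otimes> (f g \<otimes> m)" by simp
    thus "inv g \<otimes> f g \<otimes> m = m \<otimes> (inv g \<otimes> f g)"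
      using g fg mc by (simp add: m_assoc[symmetric])
  qed
  hence "g \<otimes> (inv g \<otimes> f g) = g \<otimes> \<one>" by simp
  hence "f g = g" using g fg by (simp add: m_assoc[symmetric])
  thus "f g = \<one>\<^bsub>A\<^esub> g" using g by (simp add: AutoGroup_one_apply)
qed

lemma commutes_inner_monolith_imp_one:
  assumes f: "f \<in> auto G"
    and c: "\<And>m. m \<in> monolith G \<Longrightarrow> f \<otimes>\<^bsub>A\<^esub> \<iota> m \<otimes>\<^bsub>A\<^esub> inv\<^bsub>A\<^esub> f = \<iota> m"
  shows "f = \<one>\<^bsub>A\<^esub>"
proof (rule fixes_monolith_imp_one[OF f])
  fix m assume m: "m \<in> monolith G"
  hence mc: "m \<in> carrier G" using monolith_carrier[of G] by blast
  have "\<iota> (f m) = \<iota> m" using AutoGroup_conj_inner_map[OF f mc] c[OF m] by simp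
  thus "f m = m" using inner_eqD auto_closed[OF f mc] mc by blast
qed

text \<open>
  The image of the monolith of \<open>G\<close> is normal in \<open>A\<close>. It is contained in every nontrivial normal
  subgroup \<open>K\<close> of \<open>A\<close>, because \<open>K\<close> meets the inner automorphisms in more than the identity: if \<open>f\<close> in
  \<open>K\<close> moves \<open>g\<close>, then the commutator of \<open>f\<close> with conjugation by \<open>g\<close> is conjugation by \<open>f g \<otimes> inv g\<close>.
\<close>
lemma monolith_AutoGroup: "monolith A = \<iota> ` monolith G"
proof
  have "subgroup (\<iota> ` monolith G) A" by (rule \<iota>.subgroup_img_is_subgroup[OF subgroup_monolith])
  moreover have "f \<otimes>\<^bsub>A\<^esub> x \<otimes>\<^bsub>A\<^esub> inv\<^bsub>A\<^esub> f \<in> \<iota> ` monolith G"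
    if f: "f \<in> carrier A" and x: "x \<in> \<iota> ` monolith G" for f x
  proof -
    have fa: "f \<in> auto G" using f by (simp add: AutoGroup_carrier)
    obtain m where m: "m \<in> monolith G" "x = \<iota> m" using x by blast
    have "f m \<in> monolith G" using iso_image_monolith_subset[OF auto_imp_iso[OF fa]] m by blast
    moreover have "m \<in> carrier G" using m monolith_carrier[of G] by blast
    ultimately show ?thesis using AutoGroup_conj_inner_map[OF fa] m by auto
  qed
  ultimately have "\<iota> ` monolith G \<lhd> A" by (simp add: A.normal_inv_iff)
  moreover have "\<iota> ` monolith G \<noteq> {\<one>\<^bsub>A\<^esub>}"
  proof
    assume e: "\<iota> ` monolith G = {\<one>\<^bsub>A\<^esub>}"
    have "m = \<one>" if m: "m \<in> monolith G" for m
    proof -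
      have "m \<in> carrier G" using m monolith_carrier[of G] by blast
      moreover have "\<iota> m = \<iota> \<one>" using m e by auto
      ultimately show ?thesis using inner_eqD by blast
    qed
    thus False using monolith_nontrivial subgroup.one_closed[OF subgroup_monolith] by blast
  qed
  ultimately show "monolith A \<subseteq> \<iota> ` monolith G" by (auto simp: monolith_def)
next
  have "\<iota> m \<in> K" if m: "m \<in> monolith G" and K: "K \<lhd> A" "K \<noteq> {\<one>\<^bsub>A\<^esub>}" for m K
  proof -
    interpret K: normal K A by (rule K(1))
    let ?L = "{g \<in> carrier G. \<iota> g \<in> K}"
    have "subgroup ?L G"
      by (rule subgroupI) (auto intro: exI[of _ "\<one>"])
    moreover have "g \<otimes> x \<otimes> inv g \<in> ?L" if "g \<in> carrier G" "x \<in> ?L" for g x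
      using that K.inv_op_closed2[of "\<iota> g" "\<iota> x"] by auto
    ultimately have "?L \<lhd> G" by (simp add: normal_inv_iff)
    moreover have "?L \<noteq> {\<one>}"
    proof -
      obtain f where f: "f \<in> K" "f \<noteq> \<one>\<^bsub>A\<^esub>" using K(2) K.one_closed by blast
      hence fa: "f \<in> auto G" using K.subset by (auto simp: AutoGroup_carrier)
      then obtain g where g: "g \<in> monolith G" "f g \<noteq> g"
        using fixes_monolith_imp_one f by blast
      hence gc: "g \<in> carrier G" using monolith_carrier[of G] by blast
      have fgc: "f g \<in> carrier G" using auto_closed[OF fa gc] .
      have fA: "f \<in> carrier A" using f K.subset by blast
      have "f \<otimes>\<^bsub>A\<^esub> (\<iota> g \<otimes>\<^bsub>A\<^esub> inv\<^bsub>A\<^esub> f \<otimes>\<^bsub>A\<^esub> inv\<^bsub>A\<^esub> (\<iota> g)) \<in> K"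
        using f gc K.inv_op_closed2[of "\<iota> g" "inv\<^bsub>A\<^esub> f"] by auto
      also have "f \<otimes>\<^bsub>A\<^esub> (\<iota> g \<otimes>\<^bsub>A\<^esub> inv\<^bsub>A\<^esub> f \<otimes>\<^bsub>A\<^esub> inv\<^bsub>A\<^esub> (\<iota> g)) = \<iota> (f g \<otimes> inv g)"
        using fA gc fgc AutoGroup_conj_inner_map[OF fa gc] by (simp add: A.m_assoc[symmetric])
      finally have "f g \<otimes> inv g \<in> ?L" using gc fgc by simp
      moreover have "f g \<otimes> inv g \<noteq> \<one>"
      proof
        assume "f g \<otimes> inv g = \<one>"
        hence "f g \<otimes> inv g \<otimes> g = \<one> \<otimes> g" by simp
        thus False using g gc fgc by (simp add: m_assoc)
      qed
      ultimately show ?thesis by blast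
    qed
    ultimately show ?thesis using m by (auto simp: monolith_def)
  qed
  thus "\<iota> ` monolith G \<subseteq> monolith A" using monolith_carrier[of G] by (auto simp: monolith_def)
qed

text \<open>
  This characterizes the inner automorphisms inside \<open>A\<close> by a property that every automorphism of \<open>A\<close>
  preserves.
\<close>
lemma locally_inner_AutoGroup: "locally_inner A = \<iota> ` carrier G"
proof
  show "\<iota> ` carrier G \<subseteq> locally_inner A"
  proof
    fix x assume "x \<in> \<iota> ` carrier G"
    then obtain g where g: "g \<in> carrier G" "x = \<iota> g" by blast
    have "\<exists>s\<in>monolith A. \<forall>u\<in>U. x \<otimes>\<^bsub>A\<^esub> u \<otimes>\<^bsub>A\<^esub> inv\<^bsub>A\<^esub> x = s \<otimes>\<^bsub>A\<^esub> u \<otimes>\<^bsub>A\<^esub> inv\<^bsub>A\<^esub> s"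
      if U: "finite U" "U \<subseteq> monolith A" for U
    proof -
      obtain V where V: "V \<subseteq> monolith G" "finite V" "U = \<iota> ` V"
        using U monolith_AutoGroup finite_subset_image by metis
      obtain s where s: "s \<in> monolith G" "\<forall>v\<in>V. g \<otimes> v \<otimes> inv g = s \<otimes> v \<otimes> inv s"
        using carrier_locally_inner g V unfolding locally_inner_def by blast
      have "x \<otimes>\<^bsub>A\<^esub> \<iota> v \<otimes>\<^bsub>A\<^esub> inv\<^bsub>A\<^esub> x = \<iota> s \<otimes>\<^bsub>A\<^esub> \<iota> v \<otimes>\<^bsub>A\<^esub> inv\<^bsub>A\<^esub> (\<iota> s)" if "v \<in> V" for v
      proof -
        have vs: "v \<in> carrier G" "s \<in> carrier G" using that V s monolith_carrier[of G] by auto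
        hence "\<iota> (g \<otimes> v \<otimes> inv g) = \<iota> (s \<otimes> v \<otimes> inv s)" using s that by simp
        thus ?thesis using g vs by simp
      qed
      thus ?thesis using s V monolith_AutoGroup by blast
    qed
    thus "x \<in> locally_inner A" using g by (simp add: locally_inner_def)
  qed
next
  show "locally_inner A \<subseteq> \<iota> ` carrier G"
  proof
    fix f assume f: "f \<in> locally_inner A"
    hence fA: "f \<in> carrier A" and fa: "f \<in> auto G" by (auto simp: locally_inner_def AutoGroup_carrier)
    have "\<exists>s\<in>monolith G. \<forall>u\<in>U. f u = s \<otimes> u \<otimes> inv s" if U: "finite U" "U \<subseteq> monolith G" for U
    proof -
      have "finite (\<iota> ` U)" "\<iota> ` U \<subseteq> monolith A" using U monolith_AutoGroup by auto
      then obtain t where t: "t \<in> monolith A"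
        "\<forall>x\<in>\<iota> ` U. f \<otimes>\<^bsub>A\<^esub> x \<otimes>\<^bsub>A\<^esub> inv\<^bsub>A\<^esub> f = t \<otimes>\<^bsub>A\<^esub> x \<otimes>\<^bsub>A\<^esub> inv\<^bsub>A\<^esub> t"
        using f unfolding locally_inner_def by blast
      then obtain s where s: "s \<in> monolith G" "t = \<iota> s" using monolith_AutoGroup by blast
      have "f u = s \<otimes> u \<otimes> inv s" if u: "u \<in> U" for u
      proof -
        have uc: "u \<in> carrier G" and sc: "s \<in> carrier G" using u U s monolith_carrier[of G] by auto
        have "\<iota> (f u) = \<iota> (s \<otimes> u \<otimes> inv s)"
          using AutoGroup_conj_inner_map[OF fa uc] t s u uc sc by simp
        thus ?thesis using inner_eqD[OF _ auto_closed[OF fa uc]] uc sc by simp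
      qed
      thus ?thesis using s by blast
    qed
    then obtain g where g: "g \<in> carrier G" "\<forall>u\<in>monolith G. f u = g \<otimes> u \<otimes> inv g"
      using locally_inner_auto_imp_conj[OF fa] by blast
    define h where "h = inv g"
    have h: "h \<in> carrier G" "inv h = g" using g by (simp_all add: h_def)
    have ha: "\<iota> h \<in> auto G" using h by (simp add: inner_map_auto)
    have hf: "\<iota> h \<otimes>\<^bsub>A\<^esub> f \<in> carrier A" using h fA by simp
    have "\<iota> h \<otimes>\<^bsub>A\<^esub> f = \<one>\<^bsub>A\<^esub>"
    proof (rule fixes_monolith_imp_one)
      show "\<iota> h \<otimes>\<^bsub>A\<^esub> f \<in> auto G" using hf by (simp add: AutoGroup_carrier)
      fix m assume m: "m \<in> monolith G"
      hence mc: "m \<in> carrier G" using monolith_carrier[of G] by blast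
      have "(\<iota> h \<otimes>\<^bsub>A\<^esub> f) m = h \<otimes> (g \<otimes> m \<otimes> inv g) \<otimes> inv h"
        using AutoGroup_mult_apply[OF ha fa mc] g m mc by (simp add: inner_map_apply)
      also have "\<dots> = (h \<otimes> g) \<otimes> m \<otimes> inv (h \<otimes> g)" using conj_mult[OF h(1) g(1) mc] by simp
      also have "\<dots> = m" using g mc by (simp add: h_def)
      finally show "(\<iota> h \<otimes>\<^bsub>A\<^esub> f) m = m" .
    qed
    hence "\<iota> g \<otimes>\<^bsub>A\<^esub> (\<iota> h \<otimes>\<^bsub>A\<^esub> f) = \<iota> g" using g by simp
    moreover have "\<iota> g \<otimes>\<^bsub>A\<^esub> \<iota> h = \<one>\<^bsub>A\<^esub>" using g by (simp add: h_def)
    ultimately have "f = \<iota> g" using g h fA by (simp add: A.m_assoc[symmetric])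
    thus "f \<in> \<iota> ` carrier G" using g by blast
  qed
qed

text \<open>
  An automorphism \<open>t\<close> of \<open>A\<close> preserves the inner automorphisms, hence induces an automorphism \<open>f\<close> of
  \<open>G\<close>. For \<open>a\<close> in \<open>A\<close> and \<open>g\<close> in \<open>G\<close>, applying \<open>t\<close> to the conjugate of \<open>\<iota> g\<close> by \<open>a\<close> in two ways gives
  \<open>f (a g) = t a (f g)\<close>, so \<open>t\<close> is conjugation by \<open>f\<close>.
\<close>
lemma AutoGroup_auto_is_inner:
  assumes t: "t \<in> auto A" obtains f where "f \<in> carrier A" "t = inner_map A f"
proof -
  have tiso: "t \<in> iso A A" using A.auto_imp_iso[OF t] .
  have tinn: "t ` \<iota> ` carrier G = \<iota> ` carrier G"
    using A.iso_image_locally_inner[OF tiso] locally_inner_AutoGroup by simp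
  let ?r = "inv_into (carrier G) \<iota>"
  have r: "\<iota> (?r x) = x" "?r x \<in> carrier G" if "x \<in> \<iota> ` carrier G" for x
    using that by (auto simp: f_inv_into_f inv_into_into)
  define f where "f = (\<lambda>g\<in>carrier G. ?r (t (\<iota> g)))"
  have fi: "\<iota> (f g) = t (\<iota> g)" and fc: "f g \<in> carrier G" if "g \<in> carrier G" for g
  proof -
    have "t (\<iota> g) \<in> \<iota> ` carrier G" using that tinn by blast
    thus "\<iota> (f g) = t (\<iota> g)" "f g \<in> carrier G" using r that by (auto simp: f_def)
  qed
  have fhom: "f \<in> hom G G"
  proof (rule homI)
    fix x y assume xy: "x \<in> carrier G" "y \<in> carrier G"
    have "\<iota> (f (x \<otimes> y)) = \<iota> (f x \<otimes> f y)"
      using xy fi fc A.auto_mult[OF t] by simp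
    thus "f (x \<otimes> y) = f x \<otimes> f y" using inner_eqD fc xy by simp
  qed (rule fc)
  have tinj: "inj_on t (carrier A)" using tiso by (auto simp: iso_def bij_betw_def)
  have "bij_betw f (carrier G) (carrier G)"
    unfolding bij_betw_def
  proof
    show "inj_on f (carrier G)"
    proof (rule inj_onI)
      fix x y assume xy: "x \<in> carrier G" "y \<in> carrier G" "f x = f y"
      hence "t (\<iota> x) = t (\<iota> y)" using fi by metis
      hence "\<iota> x = \<iota> y" using inj_onD[OF tinj] xy by simp
      thus "x = y" using inner_eqD xy by blast
    qed
    show "f ` carrier G = carrier G"
    proof
      show "carrier G \<subseteq> f ` carrier G"
      proof
        fix y assume y: "y \<in> carrier G"
        have "\<iota> y \<in> t ` \<iota> ` carrier G" unfolding tinn using y by blast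
        then obtain x where x: "x \<in> carrier G" "\<iota> y = t (\<iota> x)" by blast
        hence "\<iota> y = \<iota> (f x)" using fi by simp
        hence "y = f x" using inner_eqD y fc[OF x(1)] by blast
        thus "y \<in> f ` carrier G" using x by blast
      qed
    qed (use fc in blast)
  qed
  hence fa: "f \<in> auto G" using fhom by (simp add: auto_def Bij_def f_def)
  hence fA: "f \<in> carrier A" by (simp add: AutoGroup_carrier)
  have "t a = f \<otimes>\<^bsub>A\<^esub> a \<otimes>\<^bsub>A\<^esub> inv\<^bsub>A\<^esub> f" if a: "a \<in> carrier A" for a
  proof -
    have aa: "a \<in> auto G" using a by (simp add: AutoGroup_carrier)
    have tA: "t a \<in> carrier A" using A.auto_closed[OF t a] .
    have ta: "t a \<in> auto G" using tA by (simp add: AutoGroup_carrier)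
    have "t a \<otimes>\<^bsub>A\<^esub> f = f \<otimes>\<^bsub>A\<^esub> a"
    proof (rule auto_eqI)
      show "t a \<otimes>\<^bsub>A\<^esub> f \<in> auto G" "f \<otimes>\<^bsub>A\<^esub> a \<in> auto G"
        using A.m_closed tA fA a by (auto simp: AutoGroup_carrier[symmetric])
      fix g assume g: "g \<in> carrier G"
      have ag: "a g \<in> carrier G" using auto_closed[OF aa g] .
      have "\<iota> (f (a g)) = t (\<iota> (a g))" using fi ag by simp
      also have "\<dots> = t (a \<otimes>\<^bsub>A\<^esub> \<iota> g \<otimes>\<^bsub>A\<^esub> inv\<^bsub>A\<^esub> a)"
        using AutoGroup_conj_inner_map[OF aa g] by simp
      also have "\<dots> = t a \<otimes>\<^bsub>A\<^esub> t (\<iota> g) \<otimes>\<^bsub>A\<^esub> inv\<^bsub>A\<^esub> (t a)"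
        using A.iso_conj[OF tiso a] g by simp
      also have "\<dots> = t a \<otimes>\<^bsub>A\<^esub> \<iota> (f g) \<otimes>\<^bsub>A\<^esub> inv\<^bsub>A\<^esub> (t a)" using fi g by simp
      also have "\<dots> = \<iota> (t a (f g))" using AutoGroup_conj_inner_map[OF ta fc[OF g]] .
      finally have "f (a g) = t a (f g)"
        using inner_eqD auto_closed[OF ta fc[OF g]] fc[OF ag] by blast
      thus "(t a \<otimes>\<^bsub>A\<^esub> f) g = (f \<otimes>\<^bsub>A\<^esub> a) g"
        using g by (simp add: AutoGroup_mult_apply aa ta fa)
    qed
    thus ?thesis using fA a tA by (simp add: A.inv_solve_right)
  qed
  hence "t = inner_map A f"
    by (intro A.auto_eqI[OF t A.inner_map_auto[OF fA]]) (simp add: A.inner_map_apply)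
  thus ?thesis using that fA by blast
qed

lemma AutoGroup_central_imp_one:
  assumes z: "z \<in> carrier A" and c: "\<And>g. g \<in> carrier A \<Longrightarrow> z \<otimes>\<^bsub>A\<^esub> g = g \<otimes>\<^bsub>A\<^esub> z"
  shows "z = \<one>\<^bsub>A\<^esub>"
proof (rule commutes_inner_monolith_imp_one)
  show "z \<in> auto G" using z by (simp add: AutoGroup_carrier)
  fix m assume "m \<in> monolith G"
  hence "\<iota> m \<in> carrier A" using monolith_carrier[of G] by auto
  thus "z \<otimes>\<^bsub>A\<^esub> \<iota> m \<otimes>\<^bsub>A\<^esub> inv\<^bsub>A\<^esub> z = \<iota> m" using z c by (simp add: A.m_assoc)
qed

theorem AutoGroup_complete:
  "inner_map A \<in> iso A (AutoGroup A) \<and> group_center A = {\<one>\<^bsub>A\<^esub>} \<and> trivial_group (Out A)"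
proof (intro conjI)
  interpret AA: group "AutoGroup A" by (rule A.AutoGroup)
  interpret AI: group_hom A "AutoGroup A" "inner_map A"
    by unfold_locales (rule A.inner_map_hom)
  have surj: "inner_map A ` carrier A = carrier (AutoGroup A)"
  proof
    show "carrier (AutoGroup A) \<subseteq> inner_map A ` carrier A"
      using AutoGroup_auto_is_inner by (metis A.AutoGroup_carrier image_eqI subsetI)
  qed auto
  have "inj_on (inner_map A) (carrier A)"
  proof (rule AI.inj_on_one_iff[THEN iffD2], intro allI impI)
    fix z assume z: "z \<in> carrier A" and "inner_map A z = \<one>\<^bsub>AutoGroup A\<^esub>"
    hence e: "z \<otimes>\<^bsub>A\<^esub> g \<otimes>\<^bsub>A\<^esub> inv\<^bsub>A\<^esub> z = g" if "g \<in> carrier A" for g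
      using that A.AutoGroup_one_apply A.inner_map_apply by metis
    show "z = \<one>\<^bsub>A\<^esub>"
      by (rule AutoGroup_central_imp_one[OF z])
        (use e z in \<open>metis A.inv_solve_right A.m_closed\<close>)
  qed
  thus "inner_map A \<in> iso A (AutoGroup A)"
    using surj AI.homh by (simp add: iso_def bij_betw_def)
  show "group_center A = {\<one>\<^bsub>A\<^esub>}"
    using AutoGroup_central_imp_one by (auto simp: group_center_def)
  have "carrier (AutoGroup A) \<lhd> AutoGroup A"
    using AA.subgroup_self by (simp add: AA.normal_inv_iff)
  then interpret N: normal "carrier (AutoGroup A)" "AutoGroup A" .
  have "group (Out A)" using N.factorgroup_is_group surj by (simp add: Out_def)
  moreover have "carrier (Out A) = {\<one>\<^bsub>Out A\<^esub>}"
    unfolding Out_def surj by (auto simp: FactGroup_def RCOSETS_def AA.coset_join2 AA.subgroup_self)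
  ultimately show "trivial_group (Out A)" by (simp add: trivial_group_def)
qed

end

section \<open>The ring \<open>Z[1/n]\<close> and its ideal generated by \<open>n - 1\<close>\<close>

text \<open>The plain notation for inverse functions clashes with the one for inverses in a group.\<close>
abbreviation inv_map :: "('a \<Rightarrow> 'b) \<Rightarrow> 'b \<Rightarrow> 'a" where
  "inv_map f \<equiv> inv_into UNIV f"

locale dilation_base =
  fixes n :: nat
  assumes n2: "n \<ge> 2"
begin

abbreviation Zn :: "real set" where "Zn \<equiv> Z_inv n"
abbreviation pw :: "int \<Rightarrow> real" where "pw k \<equiv> real n powi k"

text \<open>
  The ideal of \<open>Z[1/n]\<close> generated by \<open>n - 1\<close>, which is the kernel of \<^const>\<open>phi\<close>
  (\<open>phi_0_iff\<close> below).
\<close>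
definition J :: "real set" where "J = (\<lambda>x. (real n - 1) * x) ` Zn"

lemma n_pos: "real n > 0" and n_gt1: "real n > 1" and n_nz [simp]: "real n \<noteq> 0" "n \<noteq> 0"
  using n2 by auto

lemma pw_pos [simp]: "pw k > 0"
  using n_pos by simp

lemma pw_add: "pw (k + l) = pw k * pw l"
  by (simp add: power_int_add)

lemma pw_minus: "pw (- k) = 1 / pw k"
  by (simp add: power_int_minus field_simps)

lemma pw_cancel [simp]: "pw k * (pw (- k) * x) = x" "pw (- k) * (pw k * x) = x"
  by (simp_all add: pw_minus)

lemma pw_eq_iff [simp]: "pw k = pw l \<longleftrightarrow> k = l"
proof (cases k l rule: linorder_cases)
  case less
  thus ?thesis using power_int_strict_increasing[of k l "real n"] n_gt1 by simp
next
  case greater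
  thus ?thesis using power_int_strict_increasing[of l k "real n"] n_gt1 by simp
qed simp

lemma ZnE: assumes "x \<in> Zn" obtains a b where "x = of_int a * pw b"
  using assms by (auto simp: Z_inv_def)

lemma ZnI: "of_int a * pw b \<in> Zn"
  by (auto simp: Z_inv_def)

lemma Zn_common_exponent:
  assumes "x \<in> Zn" "y \<in> Zn"
  obtains a c e where "x = of_int a * pw e" "y = of_int c * pw e"
proof -
  obtain a b c d where x: "x = of_int a * pw b" and y: "y = of_int c * pw d"
    using assms by (meson ZnE)
  have shift: "of_int u * pw f = of_int (u * int n ^ nat (f - e)) * pw e" if "e \<le> f" for u e f
  proof -
    have "pw f = pw (f - e) * pw e" by (simp add: pw_add[symmetric])
    also have "pw (f - e) = real n ^ nat (f - e)" using that by (simp add: power_int_def)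
    finally show ?thesis by simp
  qed
  show ?thesis
  proof (cases "b \<le> d")
    case True thus ?thesis using that[OF x] shift[OF True] y by blast
  next
    case False hence "d \<le> b" by simp
    thus ?thesis using that[OF _ y] shift[of d b] x by blast
  qed
qed

lemma Zn_of_int [simp]: "of_int a \<in> Zn"
  using ZnI[of a 0] by simp

lemma Zn_0 [simp]: "0 \<in> Zn" and Zn_1 [simp]: "1 \<in> Zn"
  using Zn_of_int[of 0] Zn_of_int[of 1] by simp_all

lemma Zn_add: "x \<in> Zn \<Longrightarrow> y \<in> Zn \<Longrightarrow> x + y \<in> Zn"
  by (erule (1) Zn_common_exponent) (metis ZnI distrib_right of_int_add)

lemma Zn_minus: "x \<in> Zn \<Longrightarrow> - x \<in> Zn"
  by (erule ZnE) (metis ZnI minus_mult_left of_int_minus)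

lemma Zn_diff: "x \<in> Zn \<Longrightarrow> y \<in> Zn \<Longrightarrow> x - y \<in> Zn"
  using Zn_add[of x "- y"] Zn_minus by simp

lemma Zn_mult: assumes "x \<in> Zn" "y \<in> Zn" shows "x * y \<in> Zn"
proof -
  obtain a b c d where x: "x = of_int a * pw b" and y: "y = of_int c * pw d"
    using assms by (meson ZnE)
  have "x * y = of_int (a * c) * pw (b + d)" by (simp add: x y pw_add)
  thus ?thesis using ZnI by metis
qed

lemma Zn_pw: "pw k \<in> Zn"
  using ZnI[of 1 k] by simp

lemma Zn_pw_mult [simp]: "pw k * x \<in> Zn \<longleftrightarrow> x \<in> Zn"
  using Zn_mult[OF Zn_pw, of x k] Zn_mult[OF Zn_pw, of "pw k * x" "- k"] by auto

lemma J_subset: "x \<in> J \<Longrightarrow> x \<in> Zn"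
proof -
  assume "x \<in> J"
  then obtain z where z: "z \<in> Zn" "x = (real n - 1) * z" by (auto simp: J_def)
  have "real n - 1 = of_int (int n - 1)" by simp
  thus "x \<in> Zn" using z Zn_mult[OF Zn_of_int[of "int n - 1"]] by metis
qed

lemma J_I: "z \<in> Zn \<Longrightarrow> (real n - 1) * z \<in> J"
  unfolding J_def by (rule imageI)

lemma JE: assumes "x \<in> J" obtains z where "z \<in> Zn" "x = (real n - 1) * z"
  using assms by (auto simp: J_def)

lemma J_0 [simp]: "0 \<in> J"
  using J_I[OF Zn_0] by simp

lemma J_add: "x \<in> J \<Longrightarrow> y \<in> J \<Longrightarrow> x + y \<in> J"
  by (elim JE) (simp add: distrib_left[symmetric] J_I Zn_add)

lemma J_minus: "x \<in> J \<Longrightarrow> - x \<in> J"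
  by (elim JE) (metis J_I Zn_minus mult_minus_right)

lemma J_diff: "x \<in> J \<Longrightarrow> y \<in> J \<Longrightarrow> x - y \<in> J"
  using J_add[of x "- y"] J_minus by simp

lemma J_mult: "x \<in> J \<Longrightarrow> y \<in> Zn \<Longrightarrow> x * y \<in> J"
  by (elim JE) (simp add: mult.assoc J_I Zn_mult)

text \<open>
  Powers of \<open>n\<close> are congruent to \<open>1\<close> modulo \<open>n - 1\<close>. This is why multiplication by a power of \<open>n\<close>
  moves the points of \<open>Z[1/n]\<close> only within their residue classes.
\<close>
lemma pw_minus_1_J: "pw k - 1 \<in> J"
proof -
  have nat: "real n ^ m - 1 \<in> J" for m
  proof (induction m)
    case (Suc m)
    have "real n ^ Suc m - 1 = (real n ^ m - 1) * pw 1 + (real n - 1) * 1" by (simp add: algebra_simps)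
    thus ?case using J_add[OF J_mult[OF Suc Zn_pw] J_I[OF Zn_1]] by metis
  qed simp
  show ?thesis
  proof (cases "k \<ge> 0")
    case True
    thus ?thesis using nat[of "nat k"] by (simp add: power_int_def)
  next
    case False
    hence "pw (- k) - 1 \<in> J" using nat[of "nat (- k)"] by (simp add: power_int_def)
    hence "- ((pw (- k) - 1) * pw k) \<in> J" by (intro J_minus J_mult Zn_pw)
    thus ?thesis by (simp add: pw_minus algebra_simps)
  qed
qed

lemma pw_mult_minus_J: "z \<in> Zn \<Longrightarrow> pw k * z - z \<in> J"
  using J_mult[OF pw_minus_1_J, of z k] by (simp add: algebra_simps)

lemma pw_minus_small:
  assumes "e > 0" obtains k :: nat where "pw (- int k) < e"
proof -
  obtain k where "(1 / real n) ^ k < e" using real_arch_pow_inv[OF assms, of "1 / real n"] n_gt1 by auto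
  thus ?thesis using that[of k] by (simp add: power_int_minus power_one_over inverse_eq_divide)
qed

lemma Zn_dense:
  assumes "x < y" obtains z where "z \<in> Zn" "x < z" "z < y"
proof -
  obtain k where k: "pw (- int k) < y - x" using pw_minus_small[of "y - x"] assms by auto
  define a where "a = \<lfloor>x * pw (int k)\<rfloor> + 1"
  have a: "x * pw (int k) < of_int a" "of_int a \<le> x * pw (int k) + 1" unfolding a_def by linarith+
  have p: "pw (int k) * pw (- int k) = 1" using pw_cancel(1)[of "int k" 1] by simp
  have "x * pw (int k) * pw (- int k) < of_int a * pw (- int k)"
    using a(1) by (intro mult_strict_right_mono) auto
  moreover have "of_int a * pw (- int k) \<le> (x * pw (int k) + 1) * pw (- int k)"
    using a(2) by (intro mult_right_mono) (auto intro: less_imp_le)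
  ultimately have "x < of_int a * pw (- int k)" "of_int a * pw (- int k) < y"
    using k by (simp_all only: mult.assoc p distrib_right)
  thus ?thesis using that ZnI by blast
qed

lemma J_dense:
  assumes "x < y" obtains z where "z \<in> J" "x < z" "z < y"
proof -
  have p: "real n - 1 > 0" using n_gt1 by simp
  obtain z where z: "z \<in> Zn" "x / (real n - 1) < z" "z < y / (real n - 1)"
    using Zn_dense[of "x / (real n - 1)" "y / (real n - 1)"] assms p by (auto simp: divide_strict_right_mono)
  have "x < (real n - 1) * z" "(real n - 1) * z < y"
    using z p by (auto simp: field_simps)
  thus ?thesis using that J_I z by blast
qed

lemma phi_0_iff: assumes "z \<in> Zn" shows "phi n z = 0 \<longleftrightarrow> z \<in> J"
proof
  obtain a b where z: "z = of_int a * pw b" using assms by (rule ZnE)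
  assume "phi n z = 0"
  hence "a mod (int n - 1) = 0" using phi_eq[OF n2] z by simp
  then obtain t where "a = (int n - 1) * t" by (auto simp: mod_eq_0_iff_dvd)
  hence "z = (real n - 1) * (of_int t * pw b)" using z by simp
  thus "z \<in> J" using J_I ZnI by metis
next
  assume "z \<in> J"
  then obtain w where w: "w \<in> Zn" "z = (real n - 1) * w" by (auto simp: J_def)
  obtain t b where "w = of_int t * pw b" using w(1) by (rule ZnE)
  hence "z = of_int ((int n - 1) * t) * pw b" using w by simp
  hence "phi n z = (int n - 1) * t mod (int n - 1)" by (simp only: phi_eq[OF n2])
  thus "phi n z = 0" by simp
qed

lemma phi_add:
  assumes "x \<in> Zn" "y \<in> Zn"
  shows "phi n (x + y) = (phi n x + phi n y) mod (int n - 1)"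
proof -
  obtain a c e where xy: "x = of_int a * pw e" "y = of_int c * pw e"
    using assms by (rule Zn_common_exponent)
  have "x + y = of_int (a + c) * pw e" using xy by (simp add: algebra_simps)
  hence "phi n (x + y) = (a + c) mod (int n - 1)" by (simp only: phi_eq[OF n2])
  thus ?thesis using xy by (simp add: phi_eq[OF n2] mod_add_eq)
qed

lemma phi_range: assumes "x \<in> Zn" shows "phi n x mod (int n - 1) = phi n x"
  using assms by (elim ZnE) (simp add: phi_eq[OF n2])

lemma phi_cong: assumes "x \<in> Zn" "y \<in> Zn" "x - y \<in> J" shows "phi n x = phi n y"
proof -
  have "phi n x = phi n (y + (x - y))" by simp
  also have "\<dots> = (phi n y + phi n (x - y)) mod (int n - 1)"
    using assms J_subset by (intro phi_add) auto
  also have "phi n (x - y) = 0" using assms phi_0_iff[of "x - y"] J_subset by blast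
  finally show ?thesis using phi_range[OF assms(2)] by simp
qed

lemma phi_diff:
  assumes "x \<in> Zn" "y \<in> Zn"
  shows "(phi n x - phi n y) mod (int n - 1) = phi n (x - y)"
proof -
  have "phi n x = phi n ((x - y) + y)" by simp
  also have "\<dots> = (phi n (x - y) + phi n y) mod (int n - 1)"
    using assms by (intro phi_add Zn_diff)
  finally show ?thesis using phi_range[OF Zn_diff[OF assms]]
    by (metis add_diff_cancel_right' mod_diff_left_eq)
qed

section \<open>Germs of piecewise linear maps\<close>

text \<open>
  A germ is recorded by two exponents, \<open>k\<close> for the slope \<open>n powi k\<close> to the right of the point and \<open>l\<close>
  for the slope to the left. Germs of this shape are closed under composition and inversion, with the
  exponents adding up.
\<close>
definition two_slope :: "int \<Rightarrow> int \<Rightarrow> real \<Rightarrow> real" where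
  "two_slope k l t = (if t \<ge> 0 then pw k * t else pw l * t)"

lemma two_slope_0 [simp]: "two_slope k l 0 = 0"
  by (simp add: two_slope_def)

lemma two_slope_same [simp]: "two_slope k k t = pw k * t"
  by (simp add: two_slope_def)

lemma two_slope_nonneg_iff [simp]: "two_slope k l t \<ge> 0 \<longleftrightarrow> t \<ge> 0"
  by (auto simp: two_slope_def zero_le_mult_iff less_imp_le not_le[of _ "0::real"])

lemma two_slope_comp: "two_slope k' l' (two_slope k l t) = two_slope (k + k') (l + l') t"
  using two_slope_nonneg_iff[of k l t]
  by (simp add: two_slope_def pw_add mult_ac split: if_splits)

lemma two_slope_inverse [simp]: "two_slope k l (two_slope (- k) (- l) t) = t"
  by (simp add: two_slope_comp)

lemma continuous_two_slope: "continuous_on UNIV (two_slope k l)"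
proof -
  have "continuous_on ({0..} \<union> {..0}) (two_slope k l)"
    unfolding two_slope_def
    by (rule continuous_on_If[of "{0..}" "{..0}"]) (auto intro!: continuous_intros)
  moreover have "{0..} \<union> {..0} = (UNIV :: real set)" by auto
  ultimately show ?thesis by simp
qed

definition has_germ :: "(real \<Rightarrow> real) \<Rightarrow> real \<Rightarrow> int \<Rightarrow> int \<Rightarrow> bool" where
  "has_germ h x k l \<longleftrightarrow> (\<forall>\<^sub>F y in nhds x. h y = h x + two_slope k l (y - x))"

lemma tendsto_two_slope: "((\<lambda>y. c + two_slope k l (y - x)) \<longlongrightarrow> c) (nhds x)"
proof -
  have "continuous_on UNIV (\<lambda>y. c + two_slope k l (y - x))"
    by (intro continuous_on_compose2[OF continuous_two_slope] continuous_intros) auto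
  hence "isCont (\<lambda>y. c + two_slope k l (y - x)) x"
    by (simp add: continuous_on_eq_continuous_at)
  thus ?thesis
    using tendsto_at_iff_tendsto_nhds[of "\<lambda>y. c + two_slope k l (y - x)" x] by (simp add: isCont_def)
qed

lemma has_germ_tendsto: assumes "has_germ h x k l" shows "(h \<longlongrightarrow> h x) (nhds x)"
  using assms tendsto_cong[of h "\<lambda>y. h x + two_slope k l (y - x)"] tendsto_two_slope[of "h x" k l x]
  by (simp add: has_germ_def)

lemma has_germ_isCont: "has_germ h x k l \<Longrightarrow> isCont h x"
  using has_germ_tendsto by (simp add: isCont_def tendsto_at_iff_tendsto_nhds)

lemma has_germ_comp:
  assumes f: "has_germ f x k l" and g: "has_germ g (f x) k' l'"
  shows "has_germ (g \<circ> f) x (k + k') (l + l')"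
proof -
  have "\<forall>\<^sub>F y in nhds x. g (f y) = g (f x) + two_slope k' l' (f y - f x)"
    using has_germ_tendsto[OF f] g unfolding has_germ_def filterlim_iff by blast
  thus ?thesis using f unfolding has_germ_def
    by eventually_elim (simp add: two_slope_comp)
qed

lemma has_germ_cong:
  assumes "has_germ g x k l" "\<forall>\<^sub>F y in nhds x. h y = g y"
  shows "has_germ h x k l"
proof -
  have "h x = g x" using eventually_nhds_x_imp_x[OF assms(2)] .
  thus ?thesis using assms unfolding has_germ_def by (auto elim: eventually_elim2)
qed

lemma has_germ_inv:
  assumes h: "has_germ h x k l" and inj: "\<And>y. g (h y) = y"
  shows "has_germ g (h x) (- k) (- l)"
proof -
  have "\<forall>\<^sub>F w in nhds (h x). h (x + two_slope (- k) (- l) (w - h x)) =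
          h x + two_slope k l (x + two_slope (- k) (- l) (w - h x) - x)"
    using tendsto_two_slope[of x "- k" "- l" "h x"] h unfolding has_germ_def filterlim_iff by blast
  hence "\<forall>\<^sub>F w in nhds (h x). h (x + two_slope (- k) (- l) (w - h x)) = w" by simp
  thus ?thesis unfolding has_germ_def inj
    by eventually_elim (metis inj)
qed

lemma has_germ_affine:
  assumes "\<forall>\<^sub>F y in nhds x. h y = pw k * y + c"
  shows "has_germ h x k k"
proof -
  have "h x = pw k * x + c" using eventually_nhds_x_imp_x[OF assms] .
  thus ?thesis using assms unfolding has_germ_def
    by (auto elim!: eventually_mono simp: algebra_simps)
qed

lemma has_germ_deriv: assumes "has_germ h x k k" shows "DERIV h x :> pw k"
proof -
  have "DERIV (\<lambda>y. h x + pw k * (y - x)) x :> pw k" by (auto intro!: derivative_eq_intros)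
  moreover have "\<forall>\<^sub>F y in nhds x. h y = h x + pw k * (y - x)"
    using assms by (simp add: has_germ_def)
  ultimately show ?thesis by (subst DERIV_cong_ev[OF refl _ refl])
qed

lemma has_germ_differentiable:
  assumes g: "has_germ h x k l" and d: "h differentiable (at x)" shows "k = l"
proof -
  obtain D where D: "DERIV h x :> D" using d by (auto simp: real_differentiable_def)
  have ev: "\<forall>\<^sub>F y in at x. h y = h x + two_slope k l (y - x)"
    using g unfolding has_germ_def by (rule eventually_nhds_conv_at[THEN iffD1, THEN conjunct1])
  have lim: "((\<lambda>y. (h y - h x) / (y - x)) \<longlongrightarrow> D) (at x)"
    using D by (simp add: has_field_derivative_iff)
  have "((\<lambda>y. (h y - h x) / (y - x)) \<longlongrightarrow> pw k) (at_right x)"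
  proof (rule tendsto_eventually)
    show "\<forall>\<^sub>F y in at_right x. (h y - h x) / (y - x) = pw k"
      using eventually_at_right_less[of x] filter_leD[OF at_le[OF subset_UNIV] ev]
      by eventually_elim (auto simp: two_slope_def)
  qed
  moreover have "((\<lambda>y. (h y - h x) / (y - x)) \<longlongrightarrow> pw l) (at_left x)"
  proof (rule tendsto_eventually)
    have "\<forall>\<^sub>F y in at_left x. y < x" by (simp add: eventually_at_filter)
    thus "\<forall>\<^sub>F y in at_left x. (h y - h x) / (y - x) = pw l"
      using filter_leD[OF at_le[OF subset_UNIV] ev]
      by eventually_elim (auto simp: two_slope_def)
  qed
  moreover have "((\<lambda>y. (h y - h x) / (y - x)) \<longlongrightarrow> D) (at_right x)"
      "((\<lambda>y. (h y - h x) / (y - x)) \<longlongrightarrow> D) (at_left x)"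
    using lim tendsto_within_subset by blast+
  ultimately have "pw k = D" "pw l = D"
    using tendsto_unique trivial_limit_at_right_real trivial_limit_at_left_real by blast+
  thus ?thesis by (metis pw_eq_iff)
qed

section \<open>The group \<open>B\<^sub>n(R)\<close> in terms of germs\<close>

text \<open>
  Membership is a condition on germs and on displacements. It will turn out that this is the carrier of
  \<open>B\<^sub>n(R)\<close>; the condition that \<open>Z[1/n]\<close> is mapped onto itself is a consequence (\<open>Zn_preimage\<close>).
\<close>
definition B_maps :: "(real \<Rightarrow> real) set" where
  "B_maps = {h. strict_mono h \<and> surj h \<and> (\<forall>x. \<exists>k l. has_germ h x k l \<and> (k = l \<or> x \<in> Zn))
              \<and> (\<forall>x\<in>Zn. h x - x \<in> J)}"

text \<open>
  At a point outside \<open>Z[1/n]\<close> the map is affine with slope a power of \<open>n\<close>. Comparing its value there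
  with the value at a nearby point of \<open>Z[1/n]\<close> puts the point itself into \<open>Z[1/n]\<close>.
\<close>
lemma Zn_preimage:
  assumes germ: "has_germ f x k l" "k = l \<or> x \<in> Zn" and Zn: "\<And>y. y \<in> Zn \<Longrightarrow> f y \<in> Zn"
    and fx: "f x \<in> Zn"
  shows "x \<in> Zn"
proof (rule ccontr)
  assume x: "x \<notin> Zn"
  hence "\<forall>\<^sub>F y in nhds x. f y = f x + pw k * (y - x)"
    using germ by (auto simp: has_germ_def)
  then obtain d where d: "d > 0" "\<And>y. dist y x < d \<Longrightarrow> f y = f x + pw k * (y - x)"
    unfolding eventually_nhds_metric by blast
  obtain z where z: "z \<in> Zn" "x < z" "z < x + d" using Zn_dense[of x "x + d"] d by auto
  hence "f z - f x = pw k * (z - x)" using d(2)[of z] by (simp add: dist_real_def)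
  hence "pw k * (z - x) \<in> Zn" using Zn_diff[OF Zn[OF z(1)] fx] by simp
  hence "z - x \<in> Zn" by simp
  hence "z - (z - x) \<in> Zn" by (rule Zn_diff[OF z(1)])
  thus False using x by simp
qed

lemma affine_slope:
  assumes "p < q" "\<forall>y\<in>{p..q}. h y = m * y + c" "slopes h \<subseteq> n_powers n"
  obtains k where "m = pw k"
proof -
  define z where "z = (p + q) / 2"
  have z: "z \<in> {p<..<q}" using assms by (auto simp: z_def)
  have "DERIV (\<lambda>y. m * y + c) z :> m" by (auto intro!: derivative_eq_intros)
  moreover have "\<forall>\<^sub>F y in nhds z. h y = m * y + c"
    using eventually_nhds_in_open[OF open_greaterThanLessThan z]
    by eventually_elim (use assms in auto)
  ultimately have "DERIV h z :> m" by (subst DERIV_cong_ev[OF refl _ refl])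
  hence "deriv h z = m" "h differentiable (at z)"
    by (auto simp: DERIV_imp_deriv real_differentiable_def)
  hence "m \<in> slopes h" unfolding slopes_def by blast
  thus ?thesis using assms(3) that by (auto simp: n_powers_def)
qed

text \<open>
  By the discreteness of the exceptional set, the map is affine on a short closed interval on either
  side of \<open>x\<close>. If the two slopes differ, then \<open>x\<close> is a break.
\<close>
lemma A_set_germ:
  assumes h: "h \<in> A_set n"
  shows "\<exists>k l. has_germ h x k l \<and> (k = l \<or> x \<in> Zn)"
proof -
  have "piecewise_linear h" using h by (simp add: A_set_def)
  then obtain S where S: "closed S" "discrete S"
    and "\<forall>p q. p < q \<and> {p<..<q} \<inter> S = {} \<longrightarrow> (\<exists>m c. \<forall>x\<in>{p..q}. h x = m * x + c)"
    unfolding piecewise_linear_def by (elim exE conjE)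
  hence aff: "\<exists>m c. \<forall>x\<in>{p..q}. h x = m * x + c" if "p < q" "{p<..<q} \<inter> S = {}" for p q
    using that by simp
  from h have sl: "slopes h \<subseteq> n_powers n" by (simp add: A_set_def)
  have "\<not> x islimpt S"
  proof (cases "x \<in> S")
    case True
    thus ?thesis using S(2) by (simp add: discrete_def isolated_in_islimpt_iff)
  next
    case False
    thus ?thesis using S(1) closed_limpt by blast
  qed
  then obtain e where e: "e > 0" "\<And>y. y \<in> S \<Longrightarrow> y \<noteq> x \<Longrightarrow> \<not> dist y x < e"
    unfolding islimpt_approachable by blast
  have "y \<notin> {x<..<x + e}" "y \<notin> {x - e<..<x}" if "y \<in> S" for y
    using e(2)[OF that] by (auto simp: dist_real_def)
  hence "{x<..<x + e} \<inter> S = {}" "{x - e<..<x} \<inter> S = {}" by blast+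
  then obtain m c m' c' where r: "\<forall>y\<in>{x..x+e}. h y = m * y + c" and l: "\<forall>y\<in>{x-e..x}. h y = m' * y + c'"
    using aff[of x "x + e"] aff[of "x - e" x] e(1) by auto
  obtain k where k: "m = pw k" using affine_slope[OF _ r sl] e(1) by auto
  obtain l where l': "m' = pw l" using affine_slope[OF _ l sl] e(1) by auto
  have hx: "h x = m * x + c" "h x = m' * x + c'" using bspec[OF r, of x] bspec[OF l, of x] e(1) by auto
  have germ: "has_germ h x k l" unfolding has_germ_def eventually_nhds_metric
  proof (intro exI[of _ e] conjI allI impI)
    fix y assume y: "dist y x < e"
    show "h y = h x + two_slope k l (y - x)"
    proof (cases "y \<ge> x")
      case True
      hence "h y = m * y + c" using r y by (auto simp: dist_real_def)
      thus ?thesis using True hx(1) k by (simp add: two_slope_def algebra_simps)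
    next
      case False
      hence "h y = m' * y + c'" using l y by (auto simp: dist_real_def)
      thus ?thesis using False hx(2) l' by (simp add: two_slope_def algebra_simps)
    qed
  qed (use e in simp)
  have "k = l" if "x \<notin> Zn"
  proof -
    have "x \<notin> breaks h" using h that by (auto simp: A_set_def)
    hence "h differentiable (at x)" by (auto simp: breaks_def dest: eventually_nhds_x_imp_x)
    thus ?thesis using has_germ_differentiable[OF germ] by blast
  qed
  thus ?thesis using germ by blast
qed

text \<open>
  On a piece with slope \<open>n powi k\<close> the displacements of two points differ by \<open>n powi k - 1\<close> times the
  difference of the points. If the slope changes at \<open>x\<close>, both points are compared with \<open>x\<close>, which then lies in
  \<open>Z[1/n]\<close>.
\<close>
lemma displacement_locally_constant:
  assumes germ: "has_germ h x k l" "k = l \<or> x \<in> Zn" and Zn: "\<And>z. z \<in> Zn \<Longrightarrow> h z \<in> Zn"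
  shows "\<exists>e>0. \<forall>y z. y \<in> Zn \<and> z \<in> Zn \<and> dist y x < e \<and> dist z x < e \<longrightarrow> (h y - y) - (h z - z) \<in> J"
proof -
  obtain e where e: "e > 0" "\<And>y. dist y x < e \<Longrightarrow> h y = h x + two_slope k l (y - x)"
    using germ(1) unfolding has_germ_def eventually_nhds_metric by blast
  have "(h y - y) - (h z - z) \<in> J" if "y \<in> Zn" "z \<in> Zn" "dist y x < e" "dist z x < e" for y z
  proof (cases "k = l")
    case True
    hence "(h y - y) - (h z - z) = pw k * (y - z) - (y - z)"
      using e(2)[OF that(3)] e(2)[OF that(4)] by (simp add: algebra_simps)
    thus ?thesis using pw_mult_minus_J[OF Zn_diff[OF that(1,2)]] by metis
  next
    case False
    hence x: "x \<in> Zn" using germ(2) by blast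
    have *: "(h w - w) - (h x - x) \<in> J" if "w \<in> Zn" "dist w x < e" for w
    proof -
      have "(h w - w) - (h x - x) = two_slope k l (w - x) - (w - x)" using e(2)[OF that(2)] by simp
      also have "\<dots> \<in> J" using pw_mult_minus_J[OF Zn_diff[OF that(1) x]] by (simp add: two_slope_def)
      finally show ?thesis .
    qed
    have "(h y - y) - (h z - z) = ((h y - y) - (h x - x)) - ((h z - z) - (h x - x))" by simp
    thus ?thesis using J_diff[OF *[OF that(1,3)] *[OF that(2,4)]] by (simp only:)
  qed
  thus ?thesis using e(1) by blast
qed

text \<open>
  The residue class of the displacement is locally constant along a dense subset of the connected line.
  Hence the value of \<^const>\<open>rho\<close> can be read off at any point of \<open>Z[1/n]\<close> (\<open>rho_eq\<close> below).
\<close>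
lemma displacement_constant:
  assumes germ: "\<And>x. \<exists>k l. has_germ h x k l \<and> (k = l \<or> x \<in> Zn)" and Zn: "\<And>z. z \<in> Zn \<Longrightarrow> h z \<in> Zn"
    and ab: "a \<in> Zn" "b \<in> Zn"
  shows "(h a - a) - (h b - b) \<in> J"
proof (rule connected_equivalence_relation_gen[of UNIV a b "\<lambda>z. z \<in> Zn"])
  show "(h x - x) - (h z - z) \<in> J" if "(h x - x) - (h y - y) \<in> J" "(h y - y) - (h z - z) \<in> J" for x y z
  proof -
    have "(h x - x) - (h z - z) = ((h x - x) - (h y - y)) + ((h y - y) - (h z - z))" by simp
    thus ?thesis using J_add[OF that] by (simp only:)
  qed
  show "\<exists>z. z \<in> T \<and> z \<in> Zn" if T: "openin (top_of_set UNIV) T" "a \<in> T" for T a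
  proof -
    obtain e where e: "e > 0" "ball a e \<subseteq> T" using T by (auto simp: open_contains_ball)
    obtain z where "z \<in> Zn" "a < z" "z < a + e" using Zn_dense[of a "a + e"] e(1) by auto
    thus ?thesis using e(2) by (intro exI[of _ z]) (auto simp: dist_real_def)
  qed
  show "\<exists>T. openin (top_of_set UNIV) T \<and> a \<in> T \<and>
          (\<forall>x\<in>T. \<forall>y\<in>T. x \<in> Zn \<and> y \<in> Zn \<longrightarrow> (h x - x) - (h y - y) \<in> J)" for a
  proof -
    obtain k l where "has_germ h a k l" "k = l \<or> a \<in> Zn" using germ by blast
    from displacement_locally_constant[OF this Zn] obtain e where "e > 0"
      "\<forall>y z. y \<in> Zn \<and> z \<in> Zn \<and> dist y a < e \<and> dist z a < e \<longrightarrow> (h y - y) - (h z - z) \<in> J"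
      by blast
    thus ?thesis by (intro exI[of _ "ball a e"]) (auto simp: dist_commute)
  qed
qed (use ab in auto)

definition non_affine :: "(real \<Rightarrow> real) \<Rightarrow> real set" where
  "non_affine h = {x. \<not> (\<exists>k. has_germ h x k k)}"

lemma has_germ_nearby:
  assumes "has_germ h x k k" shows "\<forall>\<^sub>F y in nhds x. has_germ h y k k"
proof -
  have "\<forall>\<^sub>F y in nhds x. h y = pw k * y + (h x - pw k * x)"
    using assms by (simp add: has_germ_def algebra_simps)
  hence "\<forall>\<^sub>F y in nhds x. \<forall>\<^sub>F z in nhds y. h z = pw k * z + (h x - pw k * x)"
    by (simp add: eventually_eventually)
  thus ?thesis by (rule eventually_mono) (rule has_germ_affine)
qed

lemma breaks_subset_non_affine: "breaks h \<subseteq> non_affine h"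
proof -
  have "x \<notin> breaks h" if "has_germ h x k k" for x k
  proof -
    have ev: "\<forall>\<^sub>F y in nhds x. DERIV h y :> pw k"
      using has_germ_nearby[OF that] by (rule eventually_mono) (rule has_germ_deriv)
    have "\<forall>\<^sub>F y in nhds x. h differentiable (at y)"
      using ev by (rule eventually_mono) (auto simp: real_differentiable_def)
    moreover have "\<forall>\<^sub>F y in nhds x. deriv h y = pw k"
      using ev by (rule eventually_mono) (rule DERIV_imp_deriv)
    hence "isCont (deriv h) x" using isCont_cong[of "deriv h" "\<lambda>_. pw k" x] by simp
    ultimately show ?thesis by (simp add: breaks_def)
  qed
  thus ?thesis by (auto simp: non_affine_def)
qed

text \<open>
  All points of a sufficiently small punctured neighbourhood lie in the interior of one of the two
  affine pieces, so the set of non-affine points is closed and discrete.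
\<close>
lemma not_islimpt_non_affine:
  assumes "has_germ h x k l" shows "\<not> x islimpt non_affine h"
proof -
  obtain e where e: "e > 0" "\<And>y. dist y x < e \<Longrightarrow> h y = h x + two_slope k l (y - x)"
    using assms unfolding has_germ_def eventually_nhds_metric by blast
  have "y \<notin> non_affine h" if y: "dist y x < e" "y \<noteq> x" for y
  proof (cases "y > x")
    case True
    hence "y \<in> {x<..<x+e}" using y by (auto simp: dist_real_def)
    from eventually_nhds_in_open[OF open_greaterThanLessThan this]
    have "\<forall>\<^sub>F z in nhds y. h z = pw k * z + (h x - pw k * x)"
    proof eventually_elim
      case (elim z)
      thus ?case using e(2)[of z] by (simp add: dist_real_def two_slope_def algebra_simps)
    qed
    from has_germ_affine[OF this] show ?thesis unfolding non_affine_def by blast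
  next
    case False
    hence "y \<in> {x-e<..<x}" using y by (auto simp: dist_real_def)
    from eventually_nhds_in_open[OF open_greaterThanLessThan this]
    have "\<forall>\<^sub>F z in nhds y. h z = pw l * z + (h x - pw l * x)"
    proof eventually_elim
      case (elim z)
      thus ?case using e(2)[of z] by (simp add: dist_real_def two_slope_def algebra_simps)
    qed
    from has_germ_affine[OF this] show ?thesis unfolding non_affine_def by blast
  qed
  thus ?thesis using e(1) unfolding islimpt_approachable by blast
qed

text \<open>
  The derivative is locally constant on the open interval, hence constant; continuity extends the
  affine formula to the endpoints.
\<close>
lemma affine_between_non_affine:
  assumes pq: "p < q" "{p<..<q} \<inter> non_affine h = {}" and cont: "\<And>x. isCont h x"
  shows "\<exists>m c. \<forall>x\<in>{p..q}. h x = m * x + c"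
proof -
  define z where "z = (p + q) / 2"
  have z: "z \<in> {p<..<q}" using pq by (auto simp: z_def)
  have germ: "\<exists>k. has_germ h x k k" if "x \<in> {p<..<q}" for x
    using pq(2) that by (auto simp: non_affine_def)
  have const: "deriv h z = deriv h x" if x: "x \<in> {p<..<q}" for x
  proof (rule connected_local_const[OF _ z x])
    show "\<forall>a\<in>{p<..<q}. \<forall>\<^sub>F b in at a within {p<..<q}. deriv h a = deriv h b"
    proof
      fix a assume "a \<in> {p<..<q}"
      then obtain k where k: "has_germ h a k k" using germ by blast
      have "\<forall>\<^sub>F y in nhds a. deriv h a = deriv h y"
        using has_germ_nearby[OF k]
        by (rule eventually_mono) (metis k DERIV_imp_deriv has_germ_deriv)
      thus "\<forall>\<^sub>F b in at a within {p<..<q}. deriv h a = deriv h b"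
        by (simp add: eventually_at_filter eventually_mono)
    qed
  qed simp
  define m where "m = deriv h z"
  have "h x - m * x = h p - m * p" if x: "x \<in> {p..q}" for x
  proof (rule DERIV_isconst2[OF pq(1), of "\<lambda>x. h x - m * x"])
    show "continuous_on {p..q} (\<lambda>x. h x - m * x)"
      using cont by (intro continuous_intros) (simp add: continuous_at_imp_continuous_on)
    fix y assume "p < y" "y < q"
    hence y: "y \<in> {p<..<q}" by simp
    then obtain k where k: "has_germ h y k k" using germ by blast
    have "DERIV h y :> m" using has_germ_deriv[OF k] DERIV_imp_deriv const[OF y] by (metis m_def)
    thus "DERIV (\<lambda>x. h x - m * x) y :> 0" by (auto intro!: derivative_eq_intros)
  qed (use x in auto)
  hence "\<forall>x\<in>{p..q}. h x = m * x + (h p - m * p)" by (simp add: algebra_simps)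
  thus ?thesis by blast
qed

lemma B_mapsD:
  assumes "h \<in> B_maps"
  shows "strict_mono h" "surj h" "\<exists>k l. has_germ h x k l \<and> (k = l \<or> x \<in> Zn)"
    "x \<in> Zn \<Longrightarrow> h x - x \<in> J" "inj h" "bij h" "isCont h x" "h x \<in> Zn \<longleftrightarrow> x \<in> Zn"
proof -
  show 1: "strict_mono h" "surj h" "\<exists>k l. has_germ h x k l \<and> (k = l \<or> x \<in> Zn)"
    "x \<in> Zn \<Longrightarrow> h x - x \<in> J" for x
    using assms by (simp_all add: B_maps_def)
  show "inj h" using 1(1) by (rule strict_mono_imp_inj_on)
  with 1(2) show "bij h" by (simp add: bij_def)
  show "isCont h x" using 1(3)[of x] has_germ_isCont by blast
  have Zn: "h z \<in> Zn" if "z \<in> Zn" for z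
    using Zn_add[OF that J_subset[OF 1(4)[OF that]]] by simp
  show "h x \<in> Zn \<longleftrightarrow> x \<in> Zn" using 1(3)[of x] Zn_preimage[of h x] Zn by blast
qed

lemma B_maps_inv_apply:
  assumes "h \<in> B_maps" shows "h (inv_map h y) = y" "inv_map h (h x) = x"
  using B_mapsD(2,5)[OF assms] by (simp_all add: surj_f_inv_f)

lemma B_maps_inv:
  assumes h: "h \<in> B_maps" shows "inv_map h \<in> B_maps"
proof -
  note hD = B_mapsD[OF h]
  note hi = B_maps_inv_apply[OF h]
  have "strict_mono (inv_map h)"
    using hD(1) by (metis hi(1) strict_mono_less strict_monoI)
  moreover have "surj (inv_map h)" using hi(2) by (metis surjI)
  moreover have "\<exists>k l. has_germ (inv_map h) y k l \<and> (k = l \<or> y \<in> Zn)" for y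
  proof -
    obtain k l where kl: "has_germ h (inv_map h y) k l" "k = l \<or> inv_map h y \<in> Zn" using hD(3) by blast
    have "has_germ (inv_map h) y (- k) (- l)" using has_germ_inv[OF kl(1), of "inv_map h"] hi by simp
    moreover have "- k = - l \<or> y \<in> Zn" using kl(2) hD(8)[of "inv_map h y"] hi by simp
    ultimately show ?thesis by blast
  qed
  moreover have "inv_map h y - y \<in> J" if "y \<in> Zn" for y
    using J_minus[OF hD(4)[of "inv_map h y"]] hD(8)[of "inv_map h y"] that hi by simp
  ultimately show ?thesis by (simp add: B_maps_def)
qed

lemma B_maps_comp:
  assumes f: "f \<in> B_maps" and g: "g \<in> B_maps" shows "g \<circ> f \<in> B_maps"
proof -
  note fD = B_mapsD[OF f] and gD = B_mapsD[OF g]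
  have "strict_mono (g \<circ> f)" using fD(1) gD(1) by (simp add: strict_mono_def)
  moreover have "surj (g \<circ> f)" using fD(2) gD(2) by (rule comp_surj)
  moreover have "\<exists>k l. has_germ (g \<circ> f) x k l \<and> (k = l \<or> x \<in> Zn)" for x
  proof -
    obtain k l where kl: "has_germ f x k l" "k = l \<or> x \<in> Zn" using fD(3) by blast
    obtain k' l' where kl': "has_germ g (f x) k' l'" "k' = l' \<or> f x \<in> Zn" using gD(3) by blast
    show ?thesis using has_germ_comp[OF kl(1) kl'(1)] kl(2) kl'(2) fD(8)[of x] by metis
  qed
  moreover have "(g \<circ> f) x - x \<in> J" if "x \<in> Zn" for x
    using J_add[OF gD(4)[of "f x"] fD(4)[OF that]] fD(8)[of x] that by simp
  ultimately show ?thesis by (simp add: B_maps_def)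
qed

lemma B_maps_imp_A_set: assumes h: "h \<in> B_maps" shows "h \<in> A_set n"
proof -
  note hD = B_mapsD[OF h] and iD = B_mapsD[OF B_maps_inv[OF h]]
  note hi = B_maps_inv_apply[OF h]
  have "homeomorphism UNIV UNIV h (inv_map h)"
    unfolding homeomorphism_def using hi hD(2,7) iD(2,7)
    by (auto simp: continuous_on_eq_continuous_at)
  moreover have lim: "\<not> x islimpt non_affine h" for x
    using hD(3)[of x] not_islimpt_non_affine by blast
  have disc: "discrete T" if "T \<subseteq> non_affine h" for T
    using lim islimpt_subset[OF _ that] by (auto simp: discrete_def isolated_in_islimpt_iff)
  have "closed (non_affine h)" using lim by (simp add: closed_limpt)
  hence "piecewise_linear h"
    unfolding piecewise_linear_def using disc[of "non_affine h"] affine_between_non_affine hD(7) by blast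
  moreover have "slopes h \<subseteq> n_powers n"
  proof
    fix s assume "s \<in> slopes h"
    then obtain x where x: "s = deriv h x" "h differentiable (at x)" by (auto simp: slopes_def)
    obtain k l where kl: "has_germ h x k l" using hD(3) by blast
    hence "k = l" using has_germ_differentiable x(2) by blast
    hence "s = pw k" using x(1) kl has_germ_deriv DERIV_imp_deriv by metis
    thus "s \<in> n_powers n" by (auto simp: n_powers_def)
  qed
  moreover have "breaks h \<subseteq> Zn"
  proof
    fix x assume x: "x \<in> breaks h"
    obtain k l where kl: "has_germ h x k l" "k = l \<or> x \<in> Zn" using hD(3) by blast
    thus "x \<in> Zn" using x breaks_subset_non_affine[of h] by (auto simp: non_affine_def)
  qed
  moreover have "h ` Zn = Zn"
  proof
    show "Zn \<subseteq> h ` Zn"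
    proof
      fix y assume "y \<in> Zn"
      hence "inv_map h y \<in> Zn" using hD(8)[of "inv_map h y"] hi by simp
      thus "y \<in> h ` Zn" using hi(1) by (metis imageI)
    qed
  qed (use hD(8) in auto)
  ultimately show ?thesis
    using hD(1) disc[OF breaks_subset_non_affine] unfolding A_set_def by blast
qed

lemma rho_eq:
  assumes h: "h \<in> A_set n" and z: "z \<in> Zn" shows "rho n h = phi n (h z - z)"
proof -
  have Zn: "h x \<in> Zn" if "x \<in> Zn" for x using h that by (auto simp: A_set_def)
  have c: "(phi n (h x) - phi n x) mod (int n - 1) = phi n (h z - z)" if x: "x \<in> Zn" for x
  proof -
    have "(phi n (h x) - phi n x) mod (int n - 1) = phi n (h x - x)" by (rule phi_diff[OF Zn[OF x] x])
    also have "\<dots> = phi n (h z - z)"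
      by (rule phi_cong[OF Zn_diff[OF Zn[OF x] x] Zn_diff[OF Zn[OF z] z]
            displacement_constant[OF A_set_germ[OF h] Zn x z]])
    finally show ?thesis .
  qed
  show ?thesis unfolding rho_def
    by (rule the_equality) (use c z in auto)
qed

lemma carrier_B_group: "carrier (B_group n) = B_maps"
proof
  show "carrier (B_group n) \<subseteq> B_maps"
  proof
    fix h assume "h \<in> carrier (B_group n)"
    hence h: "h \<in> A_set n" and r: "rho n h = 0"
      by (auto simp: B_group_def kernel_def A_group_def)
    have Zn: "h x \<in> Zn" if "x \<in> Zn" for x using h that by (auto simp: A_set_def)
    have "h x - x \<in> J" if x: "x \<in> Zn" for x
      using rho_eq[OF h x] r phi_0_iff[OF Zn_diff[OF Zn[OF x] x]] by simp
    moreover have "strict_mono h" "surj h"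
      using h by (auto simp: A_set_def homeomorphism_def)
    ultimately show "h \<in> B_maps" using A_set_germ[OF h] by (simp add: B_maps_def)
  qed
next
  show "B_maps \<subseteq> carrier (B_group n)"
  proof
    fix h assume h: "h \<in> B_maps"
    have A: "h \<in> A_set n" by (rule B_maps_imp_A_set[OF h])
    have d: "h 0 - 0 \<in> J" using B_mapsD(4)[OF h, of 0] by simp
    hence "rho n h = 0" using rho_eq[OF A Zn_0] phi_0_iff[OF J_subset[OF d]] by simp
    thus "h \<in> carrier (B_group n)"
      using A by (simp add: B_group_def kernel_def A_group_def)
  qed
qed

lemma B_group_simps: "monoid.mult (B_group n) f g = g \<circ> f" "\<one>\<^bsub>B_group n\<^esub> = id"
  by (simp_all add: B_group_def A_group_def)

lemma B_maps_id: "id \<in> B_maps"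
proof -
  have "has_germ id x 0 0" for x by (simp add: has_germ_def)
  moreover have "strict_mono (id :: real \<Rightarrow> real)" by (simp add: strict_mono_def)
  ultimately show ?thesis by (auto simp: B_maps_def)
qed

lemma group_B_group: "group (B_group n)"
proof (rule groupI)
  fix h assume "h \<in> carrier (B_group n)"
  hence h: "h \<in> B_maps" by (simp add: carrier_B_group)
  have "h \<circ> inv_map h = id" using B_mapsD(2)[OF h] by (simp add: surj_iff)
  thus "\<exists>y\<in>carrier (B_group n). y \<otimes>\<^bsub>B_group n\<^esub> h = \<one>\<^bsub>B_group n\<^esub>"
    using B_maps_inv[OF h] by (auto simp: carrier_B_group B_group_simps)
qed (auto simp: carrier_B_group B_group_simps B_maps_comp B_maps_id o_assoc)

lemma inv_B_group: assumes h: "h \<in> B_maps" shows "m_inv (B_group n) h = inv_map h"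
proof -
  have "h \<circ> inv_map h = id" using B_mapsD(2)[OF h] by (simp add: surj_iff)
  thus ?thesis
    using group.inv_equality[OF group_B_group, of "inv_map h" h] h B_maps_inv[OF h]
    by (simp add: carrier_B_group B_group_simps)
qed

section \<open>Affine maps, gluing and cutting off\<close>

lemma affine_B_maps: assumes c: "c \<in> J" shows "(\<lambda>x. pw k * x + c) \<in> B_maps"
proof -
  have "strict_mono (\<lambda>x. pw k * x + c)" by (simp add: strict_mono_def)
  moreover have "surj (\<lambda>x. pw k * x + c)"
    by (rule surjI[of _ "\<lambda>y. pw (- k) * (y - c)"]) simp
  moreover have "has_germ (\<lambda>x. pw k * x + c) x k k" for x
    by (rule has_germ_affine[where c = c]) simp
  moreover have "(pw k * x + c) - x \<in> J" if "x \<in> Zn" for x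
    using J_add[OF pw_mult_minus_J[OF that, of k] c] by (simp add: algebra_simps)
  ultimately show ?thesis unfolding B_maps_def by blast
qed

lemma translation_B_maps: assumes "c \<in> J" shows "(\<lambda>x. x + c) \<in> B_maps"
  using affine_B_maps[OF assms, of 0] by simp

lemma B_maps_less_iff: "h \<in> B_maps \<Longrightarrow> h x < h y \<longleftrightarrow> x < y"
  using B_mapsD(1) strict_mono_less by blast

lemma B_maps_le_iff: "h \<in> B_maps \<Longrightarrow> h x \<le> h y \<longleftrightarrow> x \<le> y"
  using B_mapsD(1) strict_mono_less_eq by blast

lemma B_maps_eq_iff: "h \<in> B_maps \<Longrightarrow> h x = h y \<longleftrightarrow> x = y"
  using B_mapsD(5) by (auto dest: injD)

definition glue :: "real \<Rightarrow> (real \<Rightarrow> real) \<Rightarrow> (real \<Rightarrow> real) \<Rightarrow> real \<Rightarrow> real" where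
  "glue p f g x = (if x \<le> p then f x else g x)"

text \<open>
  A change of slope at a point of \<open>Z[1/n]\<close> is allowed, so two maps may be glued at any such point at
  which they agree.
\<close>
lemma glue_B_maps:
  assumes f: "f \<in> B_maps" and g: "g \<in> B_maps" and p: "p \<in> Zn" and eq: "f p = g p"
  shows "glue p f g \<in> B_maps"
proof -
  have "strict_mono (glue p f g)"
  proof (rule strict_monoI)
    fix x y :: real assume xy: "x < y"
    consider "y \<le> p" | "x \<le> p" "p < y" | "p < x" by linarith
    thus "glue p f g x < glue p f g y"
    proof cases
      case 2
      have "f x \<le> f p" "g p < g y" using 2 B_maps_le_iff[OF f] B_maps_less_iff[OF g] by auto
      thus ?thesis using 2 eq by (simp add: glue_def)
    qed (use xy in \<open>auto simp: glue_def B_maps_less_iff[OF f] B_maps_less_iff[OF g]\<close>)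
  qed
  moreover have "surj (glue p f g)"
  proof (rule surjI[where f = "\<lambda>y. if y \<le> f p then inv_map f y else inv_map g y"])
    fix y
    have "inv_map f y \<le> p" if "y \<le> f p"
      using that B_maps_le_iff[OF f, of "inv_map f y" p] B_maps_inv_apply[OF f] by simp
    moreover have "\<not> inv_map g y \<le> p" if "\<not> y \<le> f p"
      using that eq B_maps_le_iff[OF g, of "inv_map g y" p] B_maps_inv_apply[OF g] by simp
    ultimately show "glue p f g (if y \<le> f p then inv_map f y else inv_map g y) = y"
      using B_maps_inv_apply[OF f] B_maps_inv_apply[OF g] by (simp add: glue_def)
  qed
  moreover have "\<exists>k l. has_germ (glue p f g) x k l \<and> (k = l \<or> x \<in> Zn)" for x
  proof -
    obtain k l where f': "has_germ f x k l" "k = l \<or> x \<in> Zn" using B_mapsD(3)[OF f] by blast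
    obtain k' l' where g': "has_germ g x k' l'" "k' = l' \<or> x \<in> Zn" using B_mapsD(3)[OF g] by blast
    consider "x < p" | "x = p" | "p < x" by linarith
    thus ?thesis
    proof cases
      case 1
      have "\<forall>\<^sub>F y in nhds x. glue p f g y = f y"
        using eventually_nhds_in_open[of "{..<p}" x] 1 by (auto simp: glue_def elim: eventually_mono)
      thus ?thesis using has_germ_cong[OF f'(1)] f'(2) by blast
    next
      case 2
      have "\<forall>\<^sub>F y in nhds x. glue p f g y = glue p f g x + two_slope k' l (y - x)"
        using f'(1) g'(1) unfolding has_germ_def
        by eventually_elim (use 2 eq in \<open>auto simp: glue_def two_slope_def\<close>)
      thus ?thesis using p 2 unfolding has_germ_def by blast
    next
      case 3
      have "\<forall>\<^sub>F y in nhds x. glue p f g y = g y"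
        using eventually_nhds_in_open[of "{p<..}" x] 3 by (auto simp: glue_def elim: eventually_mono)
      thus ?thesis using has_germ_cong[OF g'(1)] g'(2) by blast
    qed
  qed
  moreover have "glue p f g x - x \<in> J" if "x \<in> Zn" for x
    using B_mapsD(4)[OF f that] B_mapsD(4)[OF g that] by (simp add: glue_def)
  ultimately show ?thesis by (simp add: B_maps_def)
qed

text \<open>
  The identity up to \<open>a\<close>, slope \<open>n\<close> on the interval from \<open>a\<close> to \<open>a + d\<close>, and then translation by
  \<open>(n - 1) d\<close>.
\<close>
definition ramp :: "real \<Rightarrow> real \<Rightarrow> real \<Rightarrow> real" where
  "ramp a d = glue (a + d) (glue a id (\<lambda>x. pw 1 * x + (a - real n * a))) (\<lambda>x. x + (real n - 1) * d)"

lemma ramp_B_maps: assumes a: "a \<in> Zn" and d: "d \<in> Zn" "d > 0" shows "ramp a d \<in> B_maps"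
proof -
  have "a - real n * a \<in> J" using J_minus[OF J_I[OF a]] by (simp add: algebra_simps)
  hence m: "(\<lambda>x. pw 1 * x + (a - real n * a)) \<in> B_maps" by (rule affine_B_maps)
  show ?thesis unfolding ramp_def
    by (intro glue_B_maps B_maps_id m translation_B_maps J_I d a Zn_add)
      (use d in \<open>simp_all add: glue_def algebra_simps\<close>)
qed

lemma ramp_apply:
  assumes "d > 0"
  shows "x \<le> a \<Longrightarrow> ramp a d x = x" "a \<le> x \<Longrightarrow> x \<le> a + d \<Longrightarrow> ramp a d x = a + real n * (x - a)"
    "a + d \<le> x \<Longrightarrow> ramp a d x = x + (real n - 1) * d"
  using assms by (auto simp: ramp_def glue_def algebra_simps)

text \<open>
  Every element of the ideal is \<open>(n - 1) d\<close> for some \<open>d\<close> in \<open>Z[1/n]\<close>, so a ramp or the inverse of a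
  ramp interpolates between the identity and the given translation.
\<close>
lemma shift_right_of:
  assumes c: "c \<in> J"
  obtains r Q where "r \<in> B_maps" "\<And>x. x \<le> q \<Longrightarrow> r x = x" "\<And>x. Q \<le> x \<Longrightarrow> r x = x + c"
proof -
  obtain d where d: "d \<in> Zn" "c = (real n - 1) * d" using c by (rule JE)
  obtain a where a: "a \<in> Zn" "q < a" using Zn_dense[of q "q + 1"] by auto
  consider "d > 0" | "d = 0" | "d < 0" by linarith
  thus ?thesis
  proof cases
    case 1
    show ?thesis
      by (rule that[OF ramp_B_maps[OF a(1) d(1) 1], of "a + d"])
        (use a(2) 1 d(2) in \<open>auto simp: ramp_apply\<close>)
  next
    case 2
    show ?thesis by (rule that[OF B_maps_id]) (use 2 d in auto)
  next
    case 3
    hence d': "- d \<in> Zn" "- d > 0" using Zn_minus[OF d(1)] by auto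
    note R = ramp_B_maps[OF a(1) d']
    show ?thesis
    proof (rule that[OF B_maps_inv[OF R]])
      fix x
      show "inv_map (ramp a (- d)) x = x" if "x \<le> q"
        using B_maps_inv_apply(2)[OF R, of x] ramp_apply(1)[OF d'(2), of x a] that a by simp
      show "inv_map (ramp a (- d)) x = x + c" if "a - d - c \<le> x"
        using B_maps_inv_apply(2)[OF R, of "x + c"] ramp_apply(3)[OF d'(2), of a "x + c"] that d(2)
        by simp
    qed
  qed
qed

lemma shift_left_of:
  assumes c: "c \<in> J"
  obtains r P where "r \<in> B_maps" "\<And>x. x \<le> P \<Longrightarrow> r x = x" "\<And>x. p \<le> x \<Longrightarrow> r x = x + c"
proof -
  obtain r Q where r: "r \<in> B_maps" "\<And>x. x \<le> 0 \<Longrightarrow> r x = x" "\<And>x. Q \<le> x \<Longrightarrow> r x = x + c"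
    using shift_right_of[OF c, of 0] by metis
  obtain s where s: "s \<in> J" "p - Q - 1 < s" "s < p - Q" using J_dense[of "p - Q - 1" "p - Q"] by auto
  have "(\<lambda>x. x + s) \<circ> (r \<circ> (\<lambda>x. x + (- s))) \<in> B_maps"
    by (intro B_maps_comp translation_B_maps r s J_minus)
  \<comment> \<open>Conjugation by the translation by \<open>s\<close> moves the transition region \<open>[0, Q]\<close> to the left of \<open>p\<close>.\<close>
  thus ?thesis by (rule that[where P = s]) (use r s in auto)
qed

text \<open>
  At a point \<open>p'\<close> of \<open>Z[1/n]\<close> left of \<open>p\<close> the map \<open>g\<close> coincides with a translation by an element of the
  ideal, so it can be continued to the left by a map that interpolates between the identity and this
  translation.
\<close>
lemma cut_left:
  assumes g: "g \<in> B_maps"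
  obtains h P where "h \<in> B_maps" "\<And>x. p \<le> x \<Longrightarrow> h x = g x" "\<And>x. x \<le> P \<Longrightarrow> h x = x"
proof -
  obtain p' where p': "p' \<in> Zn" "p' < p" using Zn_dense[of "p - 1" p] by auto
  obtain r P where r: "r \<in> B_maps" "\<And>x. x \<le> P \<Longrightarrow> r x = x" "\<And>x. p' \<le> x \<Longrightarrow> r x = x + (g p' - p')"
    using shift_left_of[OF B_mapsD(4)[OF g p'(1)], of p'] by metis
  have "glue p' r g \<in> B_maps" using r(3) by (intro glue_B_maps r g p') auto
  thus ?thesis
    by (rule that[where P = "min P p'"]) (use p' r in \<open>auto simp: glue_def\<close>)
qed

lemma cut_right:
  assumes g: "g \<in> B_maps"
  obtains h Q where "h \<in> B_maps" "\<And>x. x \<le> q \<Longrightarrow> h x = g x" "\<And>x. Q \<le> x \<Longrightarrow> h x = x"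
proof -
  obtain q' where q': "q' \<in> Zn" "q < q'" using Zn_dense[of q "q + 1"] by auto
  define c where "c = g q' - q'"
  have c: "c \<in> J" using B_mapsD(4)[OF g q'(1)] by (simp add: c_def)
  obtain r Q where r: "r \<in> B_maps" "\<And>x. x \<le> q' \<Longrightarrow> r x = x" "\<And>x. Q \<le> x \<Longrightarrow> r x = x + (- c)"
    using shift_right_of[OF J_minus[OF c], of q'] by metis
  have "glue q' g ((\<lambda>x. x + c) \<circ> r) \<in> B_maps"
    using r(2) by (intro glue_B_maps B_maps_comp translation_B_maps r g q' c) (auto simp: c_def)
  thus ?thesis
    by (rule that[where Q = "max Q (q' + 1)"]) (use q' r in \<open>auto simp: glue_def\<close>)
qed

section \<open>Conjugation and supports\<close>

definition supported :: "(real \<Rightarrow> real) \<Rightarrow> real \<Rightarrow> real \<Rightarrow> bool" where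
  "supported h a b \<longleftrightarrow> (\<forall>x. x < a \<or> b < x \<longrightarrow> h x = x)"

definition B_compact :: "(real \<Rightarrow> real) set" where
  "B_compact = {h \<in> B_maps. \<exists>a b. supported h a b}"

lemma supported_mono: "supported h a b \<Longrightarrow> a' \<le> a \<Longrightarrow> b \<le> b' \<Longrightarrow> supported h a' b'"
  by (auto simp: supported_def)

lemma supported_inv: assumes "h \<in> B_maps" "supported h a b" shows "supported (inv_map h) a b"
  using assms B_maps_inv_apply(2)[OF assms(1)] unfolding supported_def by metis

lemma supported_maps_interval:
  assumes h: "h \<in> B_maps" "supported h a b" and x: "a \<le> x" "x \<le> b"
  shows "a \<le> h x" "h x \<le> b"
proof -
  have "h (h x) = h x \<longrightarrow> h x = x" using B_maps_eq_iff[OF h(1)] by blast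
  thus "a \<le> h x" "h x \<le> b" using h(2) x unfolding supported_def by (metis not_le)+
qed

text \<open>
  Since the group multiplies maps from left to right, conjugation by \<open>f\<close> in \<open>B\<^sub>n(R)\<close> is this map for the
  inverse of \<open>f\<close> (\<open>conj_B_group\<close> below).
\<close>
definition conj_map :: "(real \<Rightarrow> real) \<Rightarrow> (real \<Rightarrow> real) \<Rightarrow> real \<Rightarrow> real" where
  "conj_map f u = f \<circ> u \<circ> inv_map f"

lemma conj_map_B_maps: "f \<in> B_maps \<Longrightarrow> u \<in> B_maps \<Longrightarrow> conj_map f u \<in> B_maps"
  unfolding conj_map_def by (intro B_maps_comp B_maps_inv)

text \<open>
  The conjugate of \<open>u\<close> by \<open>f\<close> only depends on \<open>f\<close> on an interval that contains the support of \<open>u\<close>. This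
  is what makes bounded intervals visible to finite sets of group elements.
\<close>
lemma conj_map_cong_on_support:
  assumes f: "f \<in> B_maps" and g: "g \<in> B_maps" and u: "u \<in> B_maps" "supported u a b"
    and eq: "\<And>x. a \<le> x \<Longrightarrow> x \<le> b \<Longrightarrow> f x = g x"
  shows "conj_map f u = conj_map g u"
proof
  fix x
  define y z where "y = inv_map f x" and "z = inv_map g x"
  have yz: "f y = x" "g z = x" using B_maps_inv_apply f g by (auto simp: y_def z_def)
  show "conj_map f u x = conj_map g u x"
  proof (cases "(a \<le> y \<and> y \<le> b) \<or> (a \<le> z \<and> z \<le> b)")
    case True
    hence "y = z" using eq yz B_maps_eq_iff[OF f] B_maps_eq_iff[OF g] by metis
    thus ?thesis using True eq supported_maps_interval[OF u, of y] by (simp add: conj_map_def y_def z_def)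
  next
    case False
    hence "u y = y" "u z = z" using u(2) by (auto simp: supported_def)
    thus ?thesis using yz by (simp add: conj_map_def y_def z_def)
  qed
qed

lemma supported_conj_map:
  assumes f: "f \<in> B_maps" and u: "supported u a b"
  shows "supported (conj_map f u) (f a) (f b)"
  unfolding supported_def
proof (intro allI impI)
  fix x assume x: "x < f a \<or> f b < x"
  have "inv_map f x < a \<or> b < inv_map f x"
    using x B_maps_less_iff[OF f, of "inv_map f x" a] B_maps_less_iff[OF f, of b "inv_map f x"]
      B_maps_inv_apply(1)[OF f] by simp
  hence "u (inv_map f x) = inv_map f x" using u by (auto simp: supported_def)
  thus "conj_map f u x = x" using B_maps_inv_apply(1)[OF f] by (simp add: conj_map_def)
qed

lemma disjoint_supports_commute:
  assumes "inj p" "inj q" and dis: "\<And>x. p x = x \<or> q x = x"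
  shows "p \<circ> q = q \<circ> p"
proof
  fix x
  have "p (p x) = p x \<Longrightarrow> p x = x" "q (q x) = q x \<Longrightarrow> q x = x" using assms(1,2) by (auto dest: injD)
  thus "(p \<circ> q) x = (q \<circ> p) x" using dis[of x] dis[of "p x"] dis[of "q x"] by auto
qed

section \<open>The monolith of \<open>B\<^sub>n(R)\<close>\<close>

abbreviation B where "B \<equiv> B_group n"
abbreviation M where "M \<equiv> monolith B"

lemma conj_B_group:
  "f \<in> B_maps \<Longrightarrow> u \<in> B_maps \<Longrightarrow> f \<otimes>\<^bsub>B\<^esub> u \<otimes>\<^bsub>B\<^esub> m_inv B f = conj_map (inv_map f) u"
  using B_mapsD(6) by (simp add: inv_B_group B_group_simps conj_map_def inv_inv_eq o_assoc)

lemma M_subset: "s \<in> M \<Longrightarrow> s \<in> B_maps"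
  using monolith_carrier[of B] by (auto simp: carrier_B_group)

lemma M_inv: "s \<in> M \<Longrightarrow> inv_map s \<in> M"
  using subgroup.m_inv_closed[OF group.subgroup_monolith[OF group_B_group]] inv_B_group M_subset
  by metis

lemma B_compact_normal: "B_compact \<lhd> B"
proof -
  interpret group B by (rule group_B_group)
  have "subgroup B_compact B"
  proof (rule subgroupI)
    show "B_compact \<subseteq> carrier B" by (auto simp: B_compact_def carrier_B_group)
    show "B_compact \<noteq> {}" using B_maps_id by (force simp: B_compact_def supported_def)
    fix f assume f: "f \<in> B_compact"
    then obtain a b where fab: "f \<in> B_maps" "supported f a b" by (auto simp: B_compact_def)
    thus "m_inv B f \<in> B_compact"
      using B_maps_inv[OF fab(1)] supported_inv[OF fab] by (auto simp: B_compact_def inv_B_group)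
    fix g assume g: "g \<in> B_compact"
    obtain a b a' b' where "supported f a b" "supported g a' b'"
      using f g by (auto simp: B_compact_def)
    hence "supported (g \<circ> f) (min a a') (max b b')" by (auto simp: supported_def)
    thus "f \<otimes>\<^bsub>B\<^esub> g \<in> B_compact"
      using f g B_maps_comp by (auto simp: B_compact_def B_group_simps)
  qed
  moreover have "f \<otimes>\<^bsub>B\<^esub> u \<otimes>\<^bsub>B\<^esub> m_inv B f \<in> B_compact" if fu: "f \<in> carrier B" "u \<in> B_compact" for f u
  proof -
    have f: "f \<in> B_maps" and u: "u \<in> B_maps" using fu by (auto simp: B_compact_def carrier_B_group)
    obtain a b where "supported u a b" using fu by (auto simp: B_compact_def)
    hence "supported (conj_map (inv_map f) u) (inv_map f a) (inv_map f b)"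
      by (rule supported_conj_map[OF B_maps_inv[OF f]])
    thus ?thesis using conj_map_B_maps[OF B_maps_inv[OF f] u] conj_B_group[OF f u]
      by (auto simp: B_compact_def)
  qed
  ultimately show ?thesis by (simp add: normal_inv_iff)
qed

lemma B_compact_local:
  assumes g: "g \<in> B_maps" and P: "\<And>x. x \<le> P \<Longrightarrow> g x = x"
  obtains h a b where "h \<in> B_maps" "supported h a b" "\<And>x. x \<le> q \<Longrightarrow> h x = g x" "a \<le> b" "q \<le> b"
proof -
  obtain h Q where h: "h \<in> B_maps" "\<And>x. x \<le> q \<Longrightarrow> h x = g x" "\<And>x. Q \<le> x \<Longrightarrow> h x = x"
    using cut_right[OF g, of q] by metis
  have "supported h (min P q) (max Q q)" using h P by (auto simp: supported_def)
  thus ?thesis using that[OF h(1) _ h(2)] by auto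
qed

lemma translation_local:
  assumes c: "c \<in> J"
  obtains k where "k \<in> B_compact" "\<And>x. a \<le> x \<Longrightarrow> x \<le> b \<Longrightarrow> k x = x + c"
proof -
  obtain k P where k: "k \<in> B_maps" "\<And>x. a \<le> x \<Longrightarrow> k x = x + c" "\<And>x. x \<le> P \<Longrightarrow> k x = x"
    using cut_left[OF translation_B_maps[OF c], of a] by metis
  obtain k' a' b' where k': "k' \<in> B_maps" "supported k' a' b'" "\<And>x. x \<le> b \<Longrightarrow> k' x = k x"
    using B_compact_local[OF k(1,3), of P b] by metis
  show ?thesis by (rule that[of k']) (use k k' in \<open>auto simp: B_compact_def\<close>)
qed

lemma translation_local_nontrivial:
  obtains k where "k \<in> B_compact" "k x \<noteq> x"
proof -
  obtain c where c: "c \<in> J" "0 < c" using J_dense[of 0 1] by auto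
  obtain k where "k \<in> B_compact" "\<And>y. x \<le> y \<Longrightarrow> y \<le> x \<Longrightarrow> k y = y + c"
    using translation_local[OF c(1), of x x] by metis
  thus ?thesis using that[of k] c(2) by auto
qed

lemma M_subset_B_compact: "M \<subseteq> B_compact"
proof -
  obtain k where "k \<in> B_compact" "k 0 \<noteq> 0" by (rule translation_local_nontrivial)
  hence "B_compact \<noteq> {\<one>\<^bsub>B\<^esub>}" by (auto simp: B_group_simps)
  thus ?thesis using B_compact_normal by (auto simp: monolith_def)
qed

text \<open>
  The map \<open>x \<mapsto> n powi (-k) * x + c\<close> belongs to \<open>B\<^sub>n(R)\<close> for every \<open>c\<close> in the ideal, which is dense.
\<close>
lemma compress:
  fixes u v a b :: real
  assumes "u < v" obtains h where "h \<in> B_maps" "u < h a" "h b < v"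
proof -
  define w where "w = \<bar>b - a\<bar> + 1"
  have w: "w > 0" "b - a \<le> w"
    using abs_ge_self[of "b - a"] add_nonneg_pos[OF abs_ge_zero zero_less_one, of "b - a"]
    unfolding w_def by (simp, linarith)
  have p: "(v - u) / (2 * w) > 0" using assms w(1) by simp
  obtain k where k: "pw (- int k) < (v - u) / (2 * w)" using pw_minus_small[OF p] by blast
  define q where "q = pw (- int k)"
  have q: "q > 0" "q * w < (v - u) / 2" using k w(1) by (auto simp: q_def field_simps)
  have "q * (b - a) \<le> q * w" using q(1) w(2) by (intro mult_left_mono) auto
  hence qq: "q * b - q * a < (v - u) / 2" using q(2) by (simp add: algebra_simps)
  obtain c where c: "c \<in> J" "u - q * a < c" "c < (u + v) / 2 - q * a"
    using J_dense[of "u - q * a" "(u + v) / 2 - q * a"] assms by auto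
  show ?thesis
    by (rule that[OF affine_B_maps[OF c(1), of "- int k"]]) (use c qq in \<open>auto simp: q_def[symmetric] field_simps\<close>)
qed

lemma nontrivial_displaces_interval:
  assumes z: "z \<in> B_maps" "z \<noteq> id"
  obtains u v where "u < v" "\<And>y. u < y \<Longrightarrow> y < v \<Longrightarrow> \<not> (u < z y \<and> z y < v)"
proof -
  obtain x where "z x \<noteq> x" using z(2) by (auto simp: fun_eq_iff)
  then consider "x < z x" | "z x < x" by linarith
  thus ?thesis
  proof cases
    case 1
    show ?thesis
      by (rule that[OF 1]) (use B_maps_less_iff[OF z(1), of x] in \<open>auto dest: less_trans\<close>)
  next
    case 2
    show ?thesis
      by (rule that[OF 2]) (use B_maps_less_iff[OF z(1), of _ x] in \<open>auto dest: less_trans\<close>)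
  qed
qed

text \<open>
  Let \<open>z\<close> be a nontrivial element of a normal subgroup \<open>K\<close>. It displaces some interval from itself. An
  affine map moves the supports of \<open>f\<close> and \<open>g\<close> into this interval; for the resulting conjugates \<open>f'\<close>
  and \<open>g'\<close>, the conjugate of \<open>f'\<close> by \<open>z\<close> has support disjoint from that of \<open>g'\<close> and commutes with it.
  So \<open>commutator_mem\<close> puts the commutator of \<open>f'\<close> and \<open>g'\<close> into \<open>K\<close>, and with it the commutator of \<open>f\<close>
  and \<open>g\<close>.
\<close>
lemma commutator_in_M:
  assumes f: "f \<in> B_compact" and g: "g \<in> B_compact"
  shows "inv_map g \<circ> inv_map f \<circ> g \<circ> f \<in> M"
proof -
  interpret group B by (rule group_B_group)
  have fB: "f \<in> B_maps" and gB: "g \<in> B_maps" using f g by (auto simp: B_compact_def)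
  obtain a b a' b' where "supported f a b" "supported g a' b'"
    using f g by (auto simp: B_compact_def)
  then obtain a b where supp: "supported f a b" "supported g a b"
    using supported_mono[of f a b "min a a'" "max b b'"] supported_mono[of g a' b' "min a a'" "max b b'"]
    by auto
  have c: "f \<otimes>\<^bsub>B\<^esub> g \<otimes>\<^bsub>B\<^esub> m_inv B f \<otimes>\<^bsub>B\<^esub> m_inv B g \<in> K" if K: "K \<lhd> B" "K \<noteq> {\<one>\<^bsub>B\<^esub>}" for K
  proof -
    interpret K: normal K B by (rule K(1))
    obtain z where z: "z \<in> K" "z \<noteq> id" using K(2) K.one_closed by (auto simp: B_group_simps)
    have zB: "z \<in> B_maps" using K.subset z(1) by (auto simp: carrier_B_group)
    obtain u v where uv: "u < v" "\<And>y. u < y \<Longrightarrow> y < v \<Longrightarrow> \<not> (u < z y \<and> z y < v)"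
      using nontrivial_displaces_interval[OF zB z(2)] by metis
    obtain h where h: "h \<in> B_maps" "u < h a" "h b < v" using compress[OF uv(1)] by metis
    define t where "t = inv_map h"
    have tB: "t \<in> B_maps" and tc: "t \<in> carrier B" and ti: "inv_map t = h"
      using B_maps_inv[OF h(1)] B_mapsD(6)[OF h(1)] by (auto simp: t_def carrier_B_group inv_inv_eq)
    define f' g' where "f' = conj_map h f" and "g' = conj_map h g"
    have f': "f' \<in> B_maps" "f' = t \<otimes>\<^bsub>B\<^esub> f \<otimes>\<^bsub>B\<^esub> m_inv B t"
      and g': "g' \<in> B_maps" "g' = t \<otimes>\<^bsub>B\<^esub> g \<otimes>\<^bsub>B\<^esub> m_inv B t"
      using conj_B_group[OF tB fB] conj_B_group[OF tB gB] conj_map_B_maps[OF h(1)] fB gB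
      by (auto simp: f'_def g'_def ti)
    have fs: "f' x = x" and gs: "g' x = x" if "\<not> (u < x \<and> x < v)" for x
      using supported_conj_map[OF h(1) supp(1)] supported_conj_map[OF h(1) supp(2)] that h
      by (auto simp: f'_def g'_def supported_def)
    define e where "e = conj_map (inv_map z) f'"
    have eB: "e \<in> B_maps" using conj_map_B_maps[OF B_maps_inv[OF zB] f'(1)] by (simp add: e_def)
    have e_eq: "e = z \<otimes>\<^bsub>B\<^esub> f' \<otimes>\<^bsub>B\<^esub> m_inv B z" using conj_B_group[OF zB f'(1)] by (simp add: e_def)
    have "e x = x \<or> g' x = x" for x
    proof (cases "u < x \<and> x < v")
      case True
      hence "f' (z x) = z x" using uv(2) fs by blast
      hence "e x = x" using B_mapsD(6)[OF zB] B_maps_inv_apply(2)[OF zB]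
        by (simp add: e_def conj_map_def inv_inv_eq)
      thus ?thesis ..
    qed (use gs in blast)
    hence "g' \<circ> e = e \<circ> g'"
      using disjoint_supports_commute[of g' e] B_mapsD(5)[OF eB] B_mapsD(5)[OF g'(1)] by blast
    hence "e \<otimes>\<^bsub>B\<^esub> g' = g' \<otimes>\<^bsub>B\<^esub> e" by (simp add: B_group_simps)
    hence mem: "f' \<otimes>\<^bsub>B\<^esub> g' \<otimes>\<^bsub>B\<^esub> m_inv B f' \<otimes>\<^bsub>B\<^esub> m_inv B g' \<in> K"
      using K.commutator_mem[OF z(1), of f' g'] f'(1) g'(1) by (simp add: carrier_B_group e_eq)
    have fc: "f \<in> carrier B" and gc: "g \<in> carrier B" using fB gB by (auto simp: carrier_B_group)
    define w where "w = f \<otimes>\<^bsub>B\<^esub> g \<otimes>\<^bsub>B\<^esub> m_inv B f \<otimes>\<^bsub>B\<^esub> m_inv B g"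
    have wc: "w \<in> carrier B" using fc gc by (simp add: w_def)
    have "t \<otimes>\<^bsub>B\<^esub> w \<otimes>\<^bsub>B\<^esub> m_inv B t \<in> K"
    proof -
      have hom: "inner_map B t \<in> hom B B" using inner_map_auto[OF tc] by (simp add: auto_def)
      interpret I: group_hom B B "inner_map B t" by unfold_locales (rule hom)
      have "f' = inner_map B t f" "g' = inner_map B t g"
        using inner_map_apply fc gc f'(2) g'(2) by simp_all
      hence "inner_map B t w = f' \<otimes>\<^bsub>B\<^esub> g' \<otimes>\<^bsub>B\<^esub> m_inv B f' \<otimes>\<^bsub>B\<^esub> m_inv B g'"
        using fc gc by (simp add: w_def)
      thus ?thesis using mem inner_map_apply[OF wc] by simp
    qed
    hence "m_inv B t \<otimes>\<^bsub>B\<^esub> (t \<otimes>\<^bsub>B\<^esub> w \<otimes>\<^bsub>B\<^esub> m_inv B t) \<otimes>\<^bsub>B\<^esub> t \<in> K" using K.inv_op_closed1[OF tc] by blast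
    also have "m_inv B t \<otimes>\<^bsub>B\<^esub> (t \<otimes>\<^bsub>B\<^esub> w \<otimes>\<^bsub>B\<^esub> m_inv B t) \<otimes>\<^bsub>B\<^esub> t = w"
      using conj_mult[of "m_inv B t" t w] tc wc by simp
    finally show ?thesis by (simp add: w_def)
  qed
  have "f \<otimes>\<^bsub>B\<^esub> g \<otimes>\<^bsub>B\<^esub> m_inv B f \<otimes>\<^bsub>B\<^esub> m_inv B g \<in> carrier B" using fB gB by (simp add: carrier_B_group[symmetric])
  hence "f \<otimes>\<^bsub>B\<^esub> g \<otimes>\<^bsub>B\<^esub> m_inv B f \<otimes>\<^bsub>B\<^esub> m_inv B g \<in> M" using c by (auto simp: monolith_def)
  thus ?thesis using fB gB by (simp add: B_group_simps inv_B_group o_assoc)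
qed

text \<open>
  After cutting off \<open>g\<close> to a map \<open>h\<close> supported in \<open>[a, b]\<close>, choose \<open>k\<close> with bounded support that
  translates \<open>[a, b]\<close> to the right of itself. The commutator \<open>h \<circ> k \<circ> inv_map h \<circ> inv_map k\<close> applies
  \<open>h\<close> after a map supported in the translate of \<open>[a, b]\<close>, so up to \<open>b\<close> it coincides with \<open>h\<close>. The
  identity is kept near minus infinity, so the support can be given a prescribed left end.
\<close>
lemma M_right_local:
  assumes g: "g \<in> B_maps" and P: "\<And>x. x \<le> P \<Longrightarrow> g x = x"
  obtains s where "s \<in> M" "\<And>x. x \<le> q \<Longrightarrow> s x = g x"
proof -
  obtain h a b where h: "h \<in> B_maps" "supported h a b" "\<And>x. x \<le> q \<Longrightarrow> h x = g x" "a \<le> b" "q \<le> b"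
    using B_compact_local[OF g P, of P q] by metis
  obtain c where c: "c \<in> J" "b - a < c" using J_dense[of "b - a" "b - a + 1"] by auto
  obtain k where k: "k \<in> B_compact" "\<And>x. a \<le> x \<Longrightarrow> x \<le> b \<Longrightarrow> k x = x + c"
    using translation_local[OF c(1), of a b] by metis
  have kB: "k \<in> B_maps" using k(1) by (simp add: B_compact_def)
  have iB: "inv_map h \<in> B_maps" "inv_map k \<in> B_maps" using B_maps_inv h(1) kB by auto
  have ii: "inv_map (inv_map h) = h" "inv_map (inv_map k) = k"
    using B_mapsD(6) h(1) kB by (auto simp: inv_inv_eq)
  have hc: "inv_map h \<in> B_compact" using supported_inv[OF h(1,2)] iB by (auto simp: B_compact_def)
  have kc: "inv_map k \<in> B_compact" using k(1) supported_inv[OF kB] iB by (auto simp: B_compact_def)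
  have "h \<circ> k \<circ> inv_map h \<circ> inv_map k \<in> M"
    using commutator_in_M[OF kc hc] by (simp add: ii)
  moreover have "(h \<circ> k \<circ> inv_map h \<circ> inv_map k) x = g x" if x: "x \<le> q" for x
  proof -
    define y where "y = inv_map k x"
    have ky: "k y = x" using B_maps_inv_apply[OF kB] by (simp add: y_def)
    have "\<not> (a \<le> y \<and> y \<le> b)" using k(2)[of y] ky c(2) x h(5) by auto
    hence "inv_map h y = y" using supported_inv[OF h(1,2)] by (auto simp: supported_def)
    thus ?thesis using ky h(3)[OF x] by (simp add: y_def)
  qed
  ultimately show ?thesis using that by blast
qed

lemma M_local:
  assumes g: "g \<in> B_maps"
  obtains s where "s \<in> M" "\<And>x. p \<le> x \<Longrightarrow> x \<le> q \<Longrightarrow> s x = g x"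
proof -
  obtain h P where h: "h \<in> B_maps" "\<And>x. p \<le> x \<Longrightarrow> h x = g x" "\<And>x. x \<le> P \<Longrightarrow> h x = x"
    using cut_left[OF g, of p] by metis
  obtain s where "s \<in> M" "\<And>x. x \<le> q \<Longrightarrow> s x = h x" using M_right_local[OF h(1,3), of P q] by metis
  thus ?thesis using that[of s] h(2) by simp
qed

lemma M_moves: obtains s where "s \<in> M" "s x \<noteq> x"
proof -
  obtain c where c: "c \<in> J" "0 < c" using J_dense[of 0 1] by auto
  obtain s where s: "s \<in> M" "\<And>y. x \<le> y \<Longrightarrow> y \<le> x \<Longrightarrow> s y = y + c"
    using M_local[OF translation_B_maps[OF c(1)], of x x] by metis
  thus ?thesis using that[of s] c(2) by auto
qed

section \<open>Recognising conjugations on the monolith\<close>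

text \<open>
  A map that commutes with \<open>u\<close> permutes the points moved by \<open>u\<close>, so it cannot move points right of \<open>a\<close>
  into the region left of \<open>a\<close> where \<open>u\<close> is the identity.
\<close>
lemma commuting_fixes_boundary_ge:
  assumes z: "z \<in> B_maps" "z \<circ> u = u \<circ> z"
    and fix_u: "\<And>x. x \<le> a \<Longrightarrow> u x = x" and move: "\<And>x. a < x \<Longrightarrow> x < b \<Longrightarrow> u x \<noteq> x" and ab: "a < b"
  shows "z a \<ge> a"
proof (rule ccontr)
  assume "\<not> z a \<ge> a"
  hence "a < inv_map z a"
    using B_maps_less_iff[OF z(1), of a "inv_map z a"] B_maps_inv_apply(1)[OF z(1)] by simp
  then obtain x where x: "a < x" "x < b" "x < inv_map z a"
    using dense[of a "min b (inv_map z a)"] ab by auto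
  have "z x < a" using x(3) B_maps_less_iff[OF z(1), of x "inv_map z a"] B_maps_inv_apply(1)[OF z(1)] by simp
  hence "u (z x) = z x" using fix_u by simp
  hence "z (u x) = z x" using z(2) by (metis comp_apply)
  thus False using B_maps_eq_iff[OF z(1)] move x by blast
qed

lemma commuting_fixes_boundary:
  assumes z: "z \<in> B_maps" "z \<circ> u = u \<circ> z"
    and u: "\<And>x. x \<le> a \<Longrightarrow> u x = x" "\<And>x. a < x \<Longrightarrow> x < b \<Longrightarrow> u x \<noteq> x" "a < b"
  shows "z a = a"
proof -
  have "inv_map z \<circ> u = u \<circ> inv_map z"
  proof
    fix x
    have "z (u (inv_map z x)) = u x" using z(2) B_maps_inv_apply(1)[OF z(1)] by (metis comp_apply)
    hence "inv_map z (u x) = u (inv_map z x)" using B_maps_inv_apply(2)[OF z(1)] by metis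
    thus "(inv_map z \<circ> u) x = (u \<circ> inv_map z) x" by simp
  qed
  hence "inv_map z a \<ge> a" using commuting_fixes_boundary_ge[OF B_maps_inv[OF z(1)] _ u] by blast
  hence "a \<ge> z a"
    using B_maps_le_iff[OF z(1), of a "inv_map z a"] B_maps_inv_apply(1)[OF z(1)] by simp
  thus ?thesis using commuting_fixes_boundary_ge[OF z u] by simp
qed

text \<open>
  Since \<open>z\<close> commutes with a dilation centred at \<open>a\<close> and fixes \<open>c\<close>, it fixes points arbitrarily close
  to \<open>a\<close>. So its slope at \<open>a\<close> is \<open>1\<close> and it is the identity near \<open>a\<close>; the dilation spreads this to all
  of \<open>[a, c]\<close>.
\<close>
lemma commuting_with_dilation_id:
  assumes z: "z \<in> B_maps" "z \<circ> u = u \<circ> z" and u: "inj u"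
    and dil: "\<And>x. a \<le> x \<Longrightarrow> x \<le> c \<Longrightarrow> u x = a + real n * (x - a)"
    and fixed: "z a = a" "z c = c" and ac: "a < c" and x: "a \<le> x" "x \<le> c"
  shows "z x = x"
proof -
  define sc where "sc y k = a + (y - a) * pw (- int k)" for y k
  have sc0: "sc y 0 = y" for y by (simp add: sc_def)
  have pw_le: "pw (- int k) \<le> 1" for k
    using n_gt1 by (simp add: power_int_minus inverse_eq_divide one_le_power)
  have sc_range: "a \<le> sc y k" "sc y k \<le> c" if "a \<le> y" "y \<le> c" for y k
  proof -
    show "a \<le> sc y k" using that by (simp add: sc_def less_imp_le)
    have "(y - a) * pw (- int k) \<le> (y - a) * 1" using pw_le that by (intro mult_left_mono) auto
    thus "sc y k \<le> c" using that by (simp add: sc_def)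
  qed
  have u_sc: "u (sc y (Suc k)) = sc y k" if "a \<le> y" "y \<le> c" for y k
  proof -
    have "real n * pw (- int (Suc k)) = pw (- int k)"
      using pw_add[of 1 "- int (Suc k)"] by simp
    moreover have "u (sc y (Suc k)) = a + (y - a) * (real n * pw (- int (Suc k)))"
      using dil[OF sc_range[OF that, of "Suc k"]] by (simp add: sc_def del: of_nat_Suc)
    ultimately show ?thesis by (simp only: sc_def)
  qed
  have zu: "z (u y) = u (z y)" for y using z(2) by (metis comp_apply)
  \<comment> \<open>The orbit of \<open>c\<close> under the inverse of the dilation consists of fixed points of \<open>z\<close> tending to \<open>a\<close>.\<close>
  have fix_sc: "z (sc c k) = sc c k" for k
  proof (induction k)
    case 0 thus ?case using fixed by (simp add: sc0)
  next
    case (Suc k)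
    have us: "u (sc c (Suc k)) = sc c k" using u_sc[of c k] ac by simp
    have "u (z (sc c (Suc k))) = u (sc c (Suc k))" by (simp only: zu[symmetric] us Suc)
    thus ?case using u by (auto dest: injD)
  qed
  obtain j l where "has_germ z a j l" using B_mapsD(3)[OF z(1)] by blast
  then obtain e where e: "e > 0" "\<And>y. dist y a < e \<Longrightarrow> z y = z a + two_slope j l (y - a)"
    unfolding has_germ_def eventually_nhds_metric by blast
  have near: "z y = a + pw j * (y - a)" if "a \<le> y" "y < a + e" for y
    using e(2)[of y] that fixed by (simp add: dist_real_def two_slope_def)
  obtain k where k: "pw (- int k) < e / (c - a)" using pw_minus_small[of "e / (c - a)"] e ac by auto
  have close: "sc y k < a + e" if "a \<le> y" "y \<le> c" for y
  proof -
    have "(y - a) * pw (- int k) \<le> (c - a) * pw (- int k)"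
      using that by (intro mult_right_mono) (auto intro: less_imp_le)
    also have "\<dots> < e" using k ac by (simp add: field_simps)
    finally show ?thesis by (simp add: sc_def)
  qed
  have "sc c k = a + pw j * (sc c k - a)"
    using near[of "sc c k"] close[of c] sc_range[of c k] fix_sc[of k] ac by simp
  moreover have "sc c k - a > 0" using ac by (simp add: sc_def)
  moreover from calculation have "(pw j - 1) * (sc c k - a) = 0" by (simp add: algebra_simps)
  ultimately have "pw j = 1" by simp
  hence "z (sc x k) = sc x k" using near[of "sc x k"] close[OF x] sc_range[OF x] by simp
  hence "z (sc x 0) = sc x 0"
  proof (induction k)
    case (Suc k)
    have "z (u (sc x (Suc k))) = u (sc x (Suc k))" using zu Suc.prems by simp
    thus ?case using Suc.IH u_sc[OF x] by simp
  qed
  thus ?thesis by (simp add: sc0)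
qed

text \<open>
  The element \<open>u\<close> is the identity left of \<open>a\<close> and a dilation centred at \<open>a\<close> on \<open>[a, c]\<close>, where
  \<open>[a, c]\<close> contains \<open>[-N, N]\<close>. The element \<open>v\<close> is the identity left of \<open>c\<close> and moves the points
  immediately right of \<open>c\<close>. Maps that commute with both fix \<open>a\<close> and \<open>c\<close>.
\<close>
lemma determining_pair:
  obtains u v where "u \<in> M" "v \<in> M"
    "\<And>z x. z \<in> B_maps \<Longrightarrow> z \<circ> u = u \<circ> z \<Longrightarrow> z \<circ> v = v \<circ> z \<Longrightarrow> \<bar>x\<bar> \<le> real N \<Longrightarrow> z x = x"
proof -
  define a c where "a = - real N - 1" and "c = real N + 1"
  have "a = of_int (- int N - 1)" "c = of_int (int N + 1)" by (simp_all add: a_def c_def)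
  hence Zn: "a \<in> Zn" "c \<in> Zn" by (metis Zn_of_int)+
  have ac: "a < c" "c - a > 0" by (simp_all add: a_def c_def)
  obtain u where u: "u \<in> M" "\<And>x. x \<le> c \<Longrightarrow> u x = ramp a (c - a) x"
    using M_right_local[OF ramp_B_maps[OF Zn(1) Zn_diff[OF Zn(2,1)] ac(2)], of a c] ramp_apply(1)[OF ac(2)]
    by metis
  obtain v where v: "v \<in> M" "\<And>x. x \<le> c + 1 \<Longrightarrow> v x = ramp c 1 x"
    using M_right_local[OF ramp_B_maps[OF Zn(2) Zn_1], of c "c + 1"] ramp_apply(1)[of 1 _ c] by auto
  have u1: "u x = x" if "x \<le> a" for x using u(2)[of x] that ac ramp_apply(1)[of "c - a" x a] by simp
  have u2: "u x = a + real n * (x - a)" if "a \<le> x" "x \<le> c" for x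
    using u(2)[of x] that ac ramp_apply(2)[of "c - a" a x] by simp
  have v1: "v x = x" if "x \<le> c" for x using v(2)[of x] that ramp_apply(1)[of 1 x c] by simp
  have v2: "v x = c + real n * (x - c)" if "c \<le> x" "x \<le> c + 1" for x
    using v(2)[of x] that ramp_apply(2)[of 1 c x] by simp
  have moves: "p + real n * (x - p) \<noteq> x" if "p < x" for p x
  proof -
    have "1 * (x - p) < real n * (x - p)" using that n_gt1 by (intro mult_strict_right_mono) auto
    thus ?thesis by simp
  qed
  have "z x = x" if z: "z \<in> B_maps" "z \<circ> u = u \<circ> z" "z \<circ> v = v \<circ> z" and x: "\<bar>x\<bar> \<le> real N" for z x
  proof (rule commuting_with_dilation_id[OF z(1,2) _ u2 _ _ ac(1)])
    show "inj u" using B_mapsD(5) M_subset u(1) by blast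
    show "z a = a" by (rule commuting_fixes_boundary[OF z(1,2) u1 _ ac(1)]) (use u2 moves in auto)
    show "z c = c"
      by (rule commuting_fixes_boundary[OF z(1,3) v1, where b = "c + 1"]) (use v2 moves in auto)
  qed (use x in \<open>auto simp: a_def c_def\<close>)
  thus ?thesis using that u(1) v(1) by blast
qed

lemma commutes_with_M_imp_id:
  assumes z: "z \<in> B_maps" "\<And>m. m \<in> M \<Longrightarrow> z \<circ> m = m \<circ> z" shows "z = id"
proof
  fix x :: real
  obtain N where N: "\<bar>x\<bar> \<le> real N" using real_arch_simple by blast
  obtain u v where "u \<in> M" "v \<in> M"
    "\<And>z x. z \<in> B_maps \<Longrightarrow> z \<circ> u = u \<circ> z \<Longrightarrow> z \<circ> v = v \<circ> z \<Longrightarrow> \<bar>x\<bar> \<le> real N \<Longrightarrow> z x = x"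
    using determining_pair by blast
  thus "z x = id x" using z N by simp
qed

lemma conj_map_eq_imp_commutes:
  assumes s: "s \<in> B_maps" and t: "t \<in> B_maps" and eq: "conj_map s u = conj_map t u"
  shows "(inv_map t \<circ> s) \<circ> u = u \<circ> (inv_map t \<circ> s)"
proof
  fix x
  have "conj_map s u (s x) = conj_map t u (s x)" using eq by simp
  hence "s (u x) = t (u (inv_map t (s x)))"
    using B_maps_inv_apply(2)[OF s] by (simp add: conj_map_def)
  thus "((inv_map t \<circ> s) \<circ> u) x = (u \<circ> (inv_map t \<circ> s)) x"
    using B_maps_inv_apply(2)[OF t] by simp
qed

lemma M_finite_supported:
  assumes "finite U" "U \<subseteq> M" obtains N :: nat where "\<And>u. u \<in> U \<Longrightarrow> supported u (- real N) (real N)"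
proof -
  have "\<exists>N :: nat. \<forall>u\<in>U. supported u (- real N) (real N)"
    using assms
  proof (induction U rule: finite_induct)
    case (insert u U)
    then obtain N :: nat where N: "\<forall>u\<in>U. supported u (- real N) (real N)" by blast
    obtain a b where ab: "supported u a b" using insert.prems M_subset_B_compact by (auto simp: B_compact_def)
    obtain K :: nat where K: "max (max \<bar>a\<bar> \<bar>b\<bar>) (real N) \<le> real K" using real_arch_simple by blast
    have "supported u (- real K) (real K)" using supported_mono[OF ab] K by auto
    moreover have "\<forall>w\<in>U. supported w (- real K) (real K)"
      using N K supported_mono[of _ "- real N" "real N" "- real K" "real K"] by auto
    ultimately show ?case by blast
  qed auto
  thus ?thesis using that by blast
qed

lemma M_supported: assumes "w \<in> M" obtains N :: nat where "supported w (- real N) (real N)"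
  using M_finite_supported[of "{w}"] assms by auto

lemma conj_locally_inner:
  assumes g: "g \<in> B_maps" and U: "finite U" "U \<subseteq> M"
  obtains s where "s \<in> M" "\<And>u. u \<in> U \<Longrightarrow> conj_map g u = conj_map s u"
proof -
  obtain N where N: "\<And>u. u \<in> U \<Longrightarrow> supported u (- real N) (real N)"
    using M_finite_supported[OF U] by blast
  obtain s where s: "s \<in> M" "\<And>x. - real N \<le> x \<Longrightarrow> x \<le> real N \<Longrightarrow> s x = g x"
    using M_local[OF g, of "- real N" "real N"] by blast
  have "conj_map g u = conj_map s u" if "u \<in> U" for u
    using conj_map_cong_on_support[OF g M_subset[OF s(1)] M_subset N[OF that]] s(2) that U(2) by auto
  thus ?thesis using that s(1) by blast
qed

text \<open>
  Choose for each \<open>N\<close> an element \<open>S N\<close> of the monolith that conjugates the pair determining maps on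
  \<open>[-N, N]\<close> as \<open>\<theta>\<close> does. Enlarging the finite set by further elements cannot change the conjugating
  element on \<open>[-N, N]\<close>. So \<open>S N\<close> conjugates every element supported in \<open>[-N, N]\<close> correctly, and
  on \<open>[-N, N]\<close> it coincides with a map \<open>F\<close> that does not depend on \<open>N\<close>. A point \<open>y\<close> outside the range of \<open>F\<close> would be
  fixed by all images under \<open>\<theta>\<close>, that is, by the whole monolith.
\<close>
lemma locally_conj_imp_conj:
  assumes local: "\<And>U. finite U \<Longrightarrow> U \<subseteq> M \<Longrightarrow> \<exists>s\<in>M. \<forall>u\<in>U. \<theta> u = conj_map s u"
    and surj: "\<theta> ` M = M"
  shows "\<exists>F\<in>B_maps. \<forall>w\<in>M. \<theta> w = conj_map F w"
proof -
  have "\<exists>u v. u \<in> M \<and> v \<in> M \<and> (\<forall>z x. z \<in> B_maps \<longrightarrow> z \<circ> u = u \<circ> z \<longrightarrow> z \<circ> v = v \<circ> z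
          \<longrightarrow> \<bar>x\<bar> \<le> real N \<longrightarrow> z x = x)" for N
    using determining_pair[of N] by metis
  then obtain u v where uv: "\<And>N. u N \<in> M" "\<And>N. v N \<in> M"
    "\<And>N z x. z \<in> B_maps \<Longrightarrow> z \<circ> u N = u N \<circ> z \<Longrightarrow> z \<circ> v N = v N \<circ> z \<Longrightarrow> \<bar>x\<bar> \<le> real N \<Longrightarrow> z x = x"
    by metis
  have determined: "s x = t x"
    if s: "s \<in> M" "\<theta> (u N) = conj_map s (u N)" "\<theta> (v N) = conj_map s (v N)"
      and t: "t \<in> M" "\<theta> (u N) = conj_map t (u N)" "\<theta> (v N) = conj_map t (v N)" and x: "\<bar>x\<bar> \<le> real N"
    for s t N x
  proof -
    have sB: "s \<in> B_maps" and tB: "t \<in> B_maps" using s t M_subset by auto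
    have "(inv_map t \<circ> s) x = x"
      by (rule uv(3)[OF B_maps_comp[OF sB B_maps_inv[OF tB]]
            conj_map_eq_imp_commutes[OF sB tB] conj_map_eq_imp_commutes[OF sB tB] x])
        (use s t in simp_all)
    thus ?thesis using B_maps_inv_apply(1)[OF tB, of "s x"] by simp
  qed
  have "\<exists>s\<in>M. \<theta> (u N) = conj_map s (u N) \<and> \<theta> (v N) = conj_map s (v N)" for N
    using local[of "{u N, v N}"] uv(1,2) by auto
  then obtain S where S: "\<And>N. S N \<in> M" "\<And>N. \<theta> (u N) = conj_map (S N) (u N)"
    "\<And>N. \<theta> (v N) = conj_map (S N) (v N)" by metis
  have SB: "S N \<in> B_maps" for N using S(1) M_subset by blast
  have compat: "S N x = S K x" if "\<bar>x\<bar> \<le> real N" "\<bar>x\<bar> \<le> real K" for N K x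
  proof -
    obtain s where s: "s \<in> M" "\<forall>w\<in>{u N, v N, u K, v K}. \<theta> w = conj_map s w"
      using local[of "{u N, v N, u K, v K}"] uv(1,2) by auto
    thus ?thesis using determined[of s N "S N" x] determined[of s K "S K" x] S that by simp
  qed
  have S_conj: "\<theta> w = conj_map (S N) w" if w: "w \<in> M" "supported w (- real N) (real N)" for w N
  proof -
    obtain s where s: "s \<in> M" "\<forall>x\<in>{u N, v N, w}. \<theta> x = conj_map s x"
      using local[of "{u N, v N, w}"] uv(1,2) w(1) by auto
    have "s x = S N x" if "- real N \<le> x" "x \<le> real N" for x
      using determined[of s N "S N" x] s S that by (simp add: abs_le_iff)
    hence "conj_map s w = conj_map (S N) w"
      using conj_map_cong_on_support[OF M_subset[OF s(1)] SB M_subset[OF w(1)] w(2)] by blast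
    thus ?thesis using s(2) by simp
  qed
  \<comment> \<open>Any \<open>N\<close> with \<open>\<bar>x\<bar> \<le> N\<close> may be used here (\<open>F_eq\<close>).\<close>
  define F where "F x = S (nat \<lceil>\<bar>x\<bar>\<rceil>) x" for x
  have F_eq: "F x = S N x" if "\<bar>x\<bar> \<le> real N" for x N
    unfolding F_def by (rule compat[OF _ that]) linarith
  have "strict_mono F"
  proof (rule strict_monoI)
    fix x y :: real assume xy: "x < y"
    obtain N :: nat where N: "max \<bar>x\<bar> \<bar>y\<bar> \<le> real N" using real_arch_simple by blast
    thus "F x < F y" using F_eq[of x N] F_eq[of y N] B_maps_less_iff[OF SB] xy by simp
  qed
  moreover have "surj F"
  proof -
    have "\<exists>t. F t = y" for y
    proof -
      obtain m where m: "m \<in> M" "m y \<noteq> y" using M_moves by blast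
      then obtain w where w: "w \<in> M" "m = \<theta> w" using surj by blast
      obtain N where N: "supported w (- real N) (real N)" using M_supported[OF w(1)] by blast
      define t where "t = inv_map (S N) y"
      have St: "S N t = y" using B_maps_inv_apply(1)[OF SB] by (simp add: t_def)
      have "w t \<noteq> t" using m(2) S_conj[OF w(1) N] w(2) St by (auto simp: conj_map_def t_def)
      hence "\<not> (t < - real N \<or> real N < t)" using N unfolding supported_def by blast
      hence "\<bar>t\<bar> \<le> real N" by linarith
      thus ?thesis using F_eq St by metis
    qed
    thus ?thesis by (metis surjI)
  qed
  moreover have "\<exists>k l. has_germ F x k l \<and> (k = l \<or> x \<in> Zn)" for x
  proof -
    obtain N :: nat where N: "\<bar>x\<bar> < real N" using reals_Archimedean2 by blast
    obtain k l where kl: "has_germ (S N) x k l" "k = l \<or> x \<in> Zn" using B_mapsD(3)[OF SB] by blast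
    have "x \<in> {- real N<..<real N}" using N by auto
    from eventually_nhds_in_open[OF open_greaterThanLessThan this]
    have "\<forall>\<^sub>F y in nhds x. F y = S N y"
      by (rule eventually_mono) (auto intro!: F_eq)
    thus ?thesis using has_germ_cong[OF kl(1)] kl(2) by blast
  qed
  moreover have "F x - x \<in> J" if "x \<in> Zn" for x
    using B_mapsD(4)[OF SB that] by (simp add: F_def)
  ultimately have FB: "F \<in> B_maps" by (simp add: B_maps_def)
  have "\<theta> w = conj_map F w" if w: "w \<in> M" for w
  proof -
    obtain N where N: "supported w (- real N) (real N)" using M_supported[OF w] by blast
    have "conj_map F w = conj_map (S N) w"
      using conj_map_cong_on_support[OF FB SB M_subset[OF w] N] F_eq by (simp add: abs_le_iff)
    thus ?thesis using S_conj[OF w N] by simp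
  qed
  thus ?thesis using FB by blast
qed

text \<open>
  The passage between \<open>conj_map\<close> and conjugation in the group replaces the conjugating element by its
  inverse.
\<close>
lemma B_group_locally_conjugating: "locally_conjugating_group B"
proof -
  interpret group B by (rule group_B_group)
  have conj_map_conj: "conj_map s u = m_inv B s \<otimes>\<^bsub>B\<^esub> u \<otimes>\<^bsub>B\<^esub> m_inv B (m_inv B s)"
    if "s \<in> B_maps" "u \<in> B_maps" for s u
    using conj_B_group[OF B_maps_inv[OF that(1)] that(2)] B_mapsD(6)[OF that(1)]
    by (simp add: inv_B_group that(1) inv_inv_eq)
  show ?thesis
  proof
    obtain s :: "real \<Rightarrow> real" where "s \<in> M" "s 0 \<noteq> 0" by (rule M_moves)
    thus "M \<noteq> {\<one>\<^bsub>B\<^esub>}" by (auto simp: B_group_simps)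
  next
    fix z assume z: "z \<in> carrier B" and c: "\<And>m. m \<in> M \<Longrightarrow> z \<otimes>\<^bsub>B\<^esub> m = m \<otimes>\<^bsub>B\<^esub> z"
    have "z = id"
      by (rule commutes_with_M_imp_id) (use z c in \<open>auto simp: carrier_B_group B_group_simps\<close>)
    thus "z = \<one>\<^bsub>B\<^esub>" by (simp add: B_group_simps)
  next
    show "carrier B \<subseteq> locally_inner B"
    proof
      fix g assume g: "g \<in> carrier B"
      hence gB: "g \<in> B_maps" by (simp add: carrier_B_group)
      have "\<exists>s\<in>M. \<forall>u\<in>U. g \<otimes>\<^bsub>B\<^esub> u \<otimes>\<^bsub>B\<^esub> m_inv B g = s \<otimes>\<^bsub>B\<^esub> u \<otimes>\<^bsub>B\<^esub> m_inv B s"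
        if U: "finite U" "U \<subseteq> M" for U
      proof -
        obtain t where t: "t \<in> M" "\<And>u. u \<in> U \<Longrightarrow> conj_map (inv_map g) u = conj_map t u"
          using conj_locally_inner[OF B_maps_inv[OF gB] U] by blast
        have "g \<otimes>\<^bsub>B\<^esub> u \<otimes>\<^bsub>B\<^esub> m_inv B g = m_inv B t \<otimes>\<^bsub>B\<^esub> u \<otimes>\<^bsub>B\<^esub> m_inv B (m_inv B t)"
          if u: "u \<in> U" for u
        proof -
          have uB: "u \<in> B_maps" using u U(2) M_subset by blast
          show ?thesis using conj_B_group[OF gB uB] t(2)[OF u] conj_map_conj[OF M_subset[OF t(1)] uB] by simp
        qed
        moreover have "m_inv B t \<in> M" using M_inv[OF t(1)] inv_B_group[OF M_subset[OF t(1)]] by simp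
        ultimately show ?thesis by blast
      qed
      thus "g \<in> locally_inner B" using g by (simp add: locally_inner_def)
    qed
  next
    fix f assume f: "f \<in> auto B"
      and loc: "\<And>U. finite U \<Longrightarrow> U \<subseteq> M \<Longrightarrow> \<exists>s\<in>M. \<forall>u\<in>U. f u = s \<otimes>\<^bsub>B\<^esub> u \<otimes>\<^bsub>B\<^esub> m_inv B s"
    have loc': "\<exists>s\<in>M. \<forall>u\<in>U. f u = conj_map s u" if U: "finite U" "U \<subseteq> M" for U
    proof -
      obtain s where s: "s \<in> M" "\<forall>u\<in>U. f u = s \<otimes>\<^bsub>B\<^esub> u \<otimes>\<^bsub>B\<^esub> m_inv B s" using loc[OF U] by blast
      have "f u = conj_map (inv_map s) u" if u: "u \<in> U" for u
      proof -
        have "u \<in> B_maps" using u U(2) M_subset by blast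
        thus ?thesis using s(2) u conj_B_group[OF M_subset[OF s(1)]] by simp
      qed
      thus ?thesis using M_inv[OF s(1)] by blast
    qed
    have "\<exists>F\<in>B_maps. \<forall>w\<in>M. f w = conj_map F w"
      by (rule locally_conj_imp_conj[OF loc' iso_image_monolith[OF auto_imp_iso[OF f]]])
    then obtain F where F: "F \<in> B_maps" "\<And>w. w \<in> M \<Longrightarrow> f w = conj_map F w" by blast
    have "\<forall>u\<in>M. f u = m_inv B F \<otimes>\<^bsub>B\<^esub> u \<otimes>\<^bsub>B\<^esub> m_inv B (m_inv B F)"
      using F conj_map_conj M_subset by simp
    moreover have "m_inv B F \<in> carrier B" using F(1) by (simp add: carrier_B_group[symmetric])
    ultimately show "\<exists>g\<in>carrier B. \<forall>u\<in>M. f u = g \<otimes>\<^bsub>B\<^esub> u \<otimes>\<^bsub>B\<^esub> m_inv B g" by blast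
  qed
qed

end

section \<open>Completeness of \<open>Aut(B\<^sub>n(R))\<close>\<close>

theorem theorem2p4p3:
  fixes n :: nat
  assumes "n \<ge> 2"
  shows "inner_map (AutoGroup (B_group n))
           \<in> iso (AutoGroup (B_group n)) (AutoGroup (AutoGroup (B_group n)))
       \<and> group_center (AutoGroup (B_group n)) = {\<one>\<^bsub>AutoGroup (B_group n)\<^esub>}
       \<and> trivial_group (Out (AutoGroup (B_group n)))"
proof -
  interpret dilation_base n by unfold_locales (rule assms)
  show ?thesis
    by (rule locally_conjugating_group.AutoGroup_complete[OF B_group_locally_conjugating])
qed

end
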